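(* Let $L:[0,T]\times\mathbb{R}^N\times\mathbb{R}^N\to\mathbb{R}\cup\{\pm\infty\}$ satisfy (L1)–(L5), let $g:\mathbb{R}^N\to\mathbb{R}\cup\{\pm\infty\}$ be proper and lower semicontinuous, and let $V$ be the value function associated with $L$ and $g$. Then for every $(t_0,x_0)\in\mathrm{dom}\,V\cap[0,T)\times\mathbb{R}^N$ there exists $v_0\in\mathbb{R}^N$ such that $dV(t_0,x_0)(1,v_0)\leq-L(t_0,x_0,v_0)$.
   Context: $\mathbb{B}_R$ is the closed ball of radius $R$ at $0$; $\mathrm{dom}\,\varphi=\{z:\varphi(z)\neq\pm\infty\}$; $\varphi$ is proper if it never equals $-\infty$ and is not identically $+\infty$. Value function: for $t_0\in[0,T)$, $V(t_0,x_0)=\inf\{g(x(T))+\int_{t_0}^TL(t,x(t),\dot x(t))\,dt\}$ over absolutely continuous $x:[t_0,T]\to\mathbb{R}^N$ with $x(t_0)=x_0$; $V(T,x_0)=g(x_0)$. $V$ is regarded as $+\infty$ outside $[0,T]\times\mathbb{R}^N$. Subderivative at $z$ with $\varphi(z)$ finite: $d\varphi(z)(v)=\liminf_{\tau\to0^+,\,y\to v}(\varphi(z+\tau y)-\varphi(z))/\tau$. (L1) $L$ is lower semicontinuous in all variables. (L2) $L(t,x,\cdot)$ is convex and proper for every $t,x$. (L3) for every $(t,x,v)$ and every $(t_n,x_n)\to(t,x)$ there exist $v_n\to v$ with $L(t_n,x_n,v_n)\to L(t,x,v)$. (L4) for every $R\geq0$ there is $C_R\geq0$ with $L(t,x,v)=+\infty$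 whenever $t\in[0,T]$, $x\in\mathbb{B}_R$, $|v|>C_R$. (L5) there are an integrable $c:[0,T]\to[0,\infty)$ and a null set $\mathcal{N}$ with $L(t,x,v)=+\infty$ whenever $t\notin\mathcal{N}$ and $|v|>c(t)(1+|x|)$. *)

theory Defs
  imports "HOL-Analysis.Analysis"
begin

definition abs_cont_on :: "real \<Rightarrow> real \<Rightarrow> (real \<Rightarrow> 'a::real_normed_vector) \<Rightarrow> bool" where
  "abs_cont_on a b x \<longleftrightarrow>
     (\<forall>\<epsilon>>0. \<exists>\<delta>>0. \<forall>I::(real \<times> real) set.
        finite I \<and> (\<forall>(u,w)\<in>I. a \<le> u \<and> u \<le> w \<and> w \<le> b) \<and>
        (\<forall>(u,w)\<in>I. \<forall>(u',w')\<in>I. (u,w) \<noteq> (u',w') \<longrightarrow> {u<..<w} \<inter> {u'<..<w'} = {}) \<and>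
        (\<Sum>(u,w)\<in>I. w - u) < \<delta>
        \<longrightarrow> (\<Sum>(u,w)\<in>I. norm (x w - x u)) < \<epsilon>)"

definition ereal_integral :: "real \<Rightarrow> real \<Rightarrow> (real \<Rightarrow> ereal) \<Rightarrow> ereal" where
  "ereal_integral a b f =
     (let P = (\<integral>\<^sup>+ t\<in>{a..b}. e2ennreal (f t) \<partial>lborel);
          Q = (\<integral>\<^sup>+ t\<in>{a..b}. e2ennreal (- f t) \<partial>lborel)
      in if P = \<infinity> then \<infinity> else enn2ereal P - enn2ereal Q)"

definition value_fun ::
  "(real \<Rightarrow> 'a::euclidean_space \<Rightarrow> 'a \<Rightarrow> ereal) \<Rightarrow> ('a \<Rightarrow> ereal) \<Rightarrow> real \<Rightarrow> real \<times> 'a \<Rightarrow> ereal" where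
  "value_fun L g T z =
     (let t0 = fst z; x0 = snd z in
      if 0 \<le> t0 \<and> t0 < T then
        (INF x \<in> {x. abs_cont_on t0 T x \<and> x t0 = x0}.
           g (x T) + ereal_integral t0 T (\<lambda>t. L t (x t) (vector_derivative x (at t))))
      else if t0 = T then g x0
      else \<infinity>)"

definition subderivative :: "('b::real_normed_vector \<Rightarrow> ereal) \<Rightarrow> 'b \<Rightarrow> 'b \<Rightarrow> ereal" where
  "subderivative \<phi> z v =
     Liminf (at_right 0 \<times>\<^sub>F nhds v) (\<lambda>(\<tau>::real, y). (\<phi> (z + \<tau> *\<^sub>R y) - \<phi> z) / ereal \<tau>)"

end

theory Submission
  imports Defs
begin

text \<open>
  No minimiser is needed. For \<open>\<tau> > 0\<close> take an arc \<open>x\<close> that is \<open>\<tau>\<^sup>2\<close>-optimal for \<open>V(t0,x0)\<close> and put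
  \<open>v = (x(t0+\<tau>) - x0)/\<tau>\<close>. By (L4) these quotients stay bounded, so along some \<open>\<tau> \<rightarrow> 0\<close> they converge to
  a vector \<open>v0\<close>. Given a real \<open>c < L(t0,x0,v0)\<close>, separating \<open>(v0,c)\<close> from the closed convex epigraph of
  \<open>L(t0,x0,\<cdot>)\<close> yields an affine function \<open>\<ell> < L(t0,x0,\<cdot>)\<close> with \<open>\<ell>(v0) > c\<close>; lower semicontinuity and (L4)
  make \<open>\<ell> \<le> L(t,x,\<cdot>)\<close> for all \<open>(t,x)\<close> near \<open>(t0,x0)\<close>. Hence the running cost of \<open>x\<close> on \<open>[t0,t0+\<tau>]\<close> is at
  least \<open>\<tau> \<ell>(v)\<close>, and \<open>V(t0+\<tau>, x0+\<tau> v) \<le> V(t0,x0) + \<tau>\<^sup>2 - \<tau> \<ell>(v)\<close>.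

  Integrating \<open>\<ell>\<close> along \<open>x'\<close> uses the Lebesgue fundamental theorem of calculus for absolutely continuous
  arcs. A real absolutely continuous function is a difference of increasing ones (via its variation);
  the Stieltjes measure of an increasing one has a Radon-Nikodym density, and Vitali's covering theorem
  shows that this density is the derivative almost everywhere.
\<close>

section \<open>Variation of absolutely continuous functions\<close>

text \<open>Unlike in \<open>abs_cont_on\<close>, intervals must be nondegenerate; then members of different families with
  disjoint hulls are distinct, and \<open>increments\<close> is additive over such families.\<close>

definition nonoverlapping :: "real \<Rightarrow> real \<Rightarrow> (real \<times> real) set \<Rightarrow> bool" where
  "nonoverlapping a b I \<longleftrightarrow> finite I \<and> (\<forall>p\<in>I. a \<le> fst p \<and> fst p < snd p \<and> snd p \<le> b) \<and>
     disjoint_family_on (\<lambda>p. {fst p<..<snd p}) I"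

definition increments :: "(real \<Rightarrow> real) \<Rightarrow> (real \<times> real) set \<Rightarrow> real" where
  "increments f I = (\<Sum>p\<in>I. \<bar>f (snd p) - f (fst p)\<bar>)"

text \<open>The total length of a family is written \<open>increments id I\<close>, so identities
  proved for \<open>increments\<close> with arbitrary \<open>f\<close> apply to lengths as
  well.\<close>

definition ac_real :: "real \<Rightarrow> real \<Rightarrow> (real \<Rightarrow> real) \<Rightarrow> bool" where
  "ac_real a b f \<longleftrightarrow> (\<forall>e>0. \<exists>d>0. \<forall>I. nonoverlapping a b I \<and> increments id I < d \<longrightarrow> increments f I < e)"

text \<open>This is the total variation of \<open>f\<close>. The supremum of reals is meaningful
  only once the increments are bounded, which \<open>ac_real_bounded_increments\<close>
  provides.\<close>

definition variation :: "(real \<Rightarrow> real) \<Rightarrow> real \<Rightarrow> real \<Rightarrow> real" where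
  "variation f a b = (SUP I\<in>{I. nonoverlapping a b I}. increments f I)"

section \<open>Families of nonoverlapping intervals\<close>

lemma nonoverlapping_empty [simp]: "nonoverlapping a b {}"
  by (simp add: nonoverlapping_def disjoint_family_on_def)

lemma nonoverlapping_single: "a \<le> u \<Longrightarrow> u < w \<Longrightarrow> w \<le> b \<Longrightarrow> nonoverlapping a b {(u, w)}"
  by (simp add: nonoverlapping_def disjoint_family_on_def)

lemma nonoverlapping_mono:
  "nonoverlapping a b I \<Longrightarrow> a' \<le> a \<Longrightarrow> b \<le> b' \<Longrightarrow> nonoverlapping a' b' I"
  unfolding nonoverlapping_def by force

lemma increments_empty [simp]: "increments f {} = 0"
  by (simp add: increments_def)

lemma increments_single [simp]: "increments f {(u, w)} = \<bar>f w - f u\<bar>"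
  by (simp add: increments_def)

lemma increments_id: "nonoverlapping a b I \<Longrightarrow> increments id I = (\<Sum>p\<in>I. snd p - fst p)"
  unfolding increments_def nonoverlapping_def by (intro sum.cong) auto

lemma increments_id_le:
  assumes "nonoverlapping a b I" "a \<le> b"
  shows "increments id I \<le> b - a"
proof -
  have fin: "finite I" using assms by (simp add: nonoverlapping_def)
  have "increments id I = (\<Sum>p\<in>I. measure lborel {fst p<..<snd p})"
    unfolding increments_id[OF assms(1)] using assms by (intro sum.cong) (auto simp: nonoverlapping_def)
  also have "\<dots> = measure lborel (\<Union>p\<in>I. {fst p<..<snd p})"
    using assms fin by (intro measure_finite_Union[symmetric]) (auto simp: nonoverlapping_def)
  also have "\<dots> \<le> measure lborel {a..b}"
  proof (rule measure_mono_fmeasurable)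
    show "(\<Union>p\<in>I. {fst p<..<snd p}) \<subseteq> {a..b}" using assms by (fastforce simp: nonoverlapping_def)
    show "(\<Union>p\<in>I. {fst p<..<snd p}) \<in> sets lborel" using fin by (intro sets.finite_UN) auto
    show "{a..b} \<in> fmeasurable lborel" by (simp add: fmeasurable_def emeasure_lborel_Icc_eq)
  qed
  finally show ?thesis using assms by simp
qed

lemma abs_cont_on_imp_ac_real:
  assumes "abs_cont_on a b x" "c \<in> Basis"
  shows "ac_real a b (\<lambda>t. x t \<bullet> c)"
  unfolding ac_real_def
proof (intro allI impI)
  fix e :: real assume "e > 0"
  from assms(1)[unfolded abs_cont_on_def, THEN spec, THEN mp, OF this]
  obtain d where d: "d > 0" and *: "\<forall>I. finite I \<and> (\<forall>(u,w)\<in>I. a \<le> u \<and> u \<le> w \<and> w \<le> b) \<and>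
        (\<forall>(u,w)\<in>I. \<forall>(u',w')\<in>I. (u,w) \<noteq> (u',w') \<longrightarrow> {u<..<w} \<inter> {u'<..<w'} = {}) \<and>
        (\<Sum>(u,w)\<in>I. w - u) < d \<longrightarrow> (\<Sum>(u,w)\<in>I. norm (x w - x u)) < e"
    by (elim exE conjE)
  have "increments (\<lambda>t. x t \<bullet> c) I < e" if I: "nonoverlapping a b I" "increments id I < d" for I
  proof -
    have "(\<Sum>(u,w)\<in>I. norm (x w - x u)) < e"
    proof (rule *[THEN spec, THEN mp], intro conjI)
      show "finite I" using I by (simp add: nonoverlapping_def)
      show "\<forall>(u,w)\<in>I. a \<le> u \<and> u \<le> w \<and> w \<le> b" using I by (force simp: nonoverlapping_def)
      show "\<forall>(u,w)\<in>I. \<forall>(u',w')\<in>I. (u,w) \<noteq> (u',w') \<longrightarrow> {u<..<w} \<inter> {u'<..<w'} = {}"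
        using I unfolding nonoverlapping_def disjoint_family_on_def by fastforce
      show "(\<Sum>(u,w)\<in>I. w - u) < d" using I increments_id[OF I(1)] by (simp add: case_prod_beta)
    qed
    moreover have "increments (\<lambda>t. x t \<bullet> c) I \<le> (\<Sum>(u,w)\<in>I. norm (x w - x u))"
      unfolding increments_def case_prod_beta
      by (intro sum_mono) (metis Basis_le_norm assms(2) inner_diff_left)
    ultimately show ?thesis by simp
  qed
  then show "\<exists>d>0. \<forall>I. nonoverlapping a b I \<and> increments id I < d \<longrightarrow> increments (\<lambda>t. x t \<bullet> c) I < e"
    using d by blast
qed

text \<open>Both endpoints of every interval are projected onto \<open>{p..q}\<close>. Projection
  never enlarges the interior, so disjointness survives; intervals that collapse are discarded, as
  \<open>nonoverlapping\<close> demands, and contribute 0 to the sum. One \<open>J\<close> serves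
  every \<open>f\<close>.\<close>

lemma nonoverlapping_clamp:
  assumes "nonoverlapping a b I" "p \<le> q"
  obtains J where "nonoverlapping p q J"
    "\<And>f. increments f J = (\<Sum>i\<in>I. \<bar>f (max p (min q (snd i))) - f (max p (min q (fst i)))\<bar>)"
proof -
  define cl where "cl = (\<lambda>t. max p (min q t))"
  have mono: "u \<le> w \<Longrightarrow> cl u \<le> cl w" for u w by (auto simp: cl_def)
  have in_cl: "u < z \<and> z < w" if "cl u < z" "z < cl w" for u w z
    using that by (auto simp: cl_def max_def min_def split: if_splits)
  define I' where "I' = {i\<in>I. cl (fst i) < cl (snd i)}"
  define h where "h = (\<lambda>i. (cl (fst i), cl (snd i)))"
  have fin: "finite I" "finite I'" using assms by (auto simp: nonoverlapping_def I'_def)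
  have disj: "{cl (fst i)<..<cl (snd i)} \<inter> {cl (fst j)<..<cl (snd j)} = {}"
    if "i \<in> I'" "j \<in> I'" "i \<noteq> j" for i j
  proof -
    have "{fst i<..<snd i} \<inter> {fst j<..<snd j} = {}"
      using that assms unfolding nonoverlapping_def disjoint_family_on_def I'_def by blast
    moreover have "{cl u<..<cl w} \<subseteq> {u<..<w}" for u w using in_cl by (meson greaterThanLessThan_iff subsetI)
    ultimately show ?thesis by blast
  qed
  \<comment> \<open>Distinct intervals with equal images would make that image disjoint from itself,
    hence empty, contrary to the choice of \<open>I'\<close>.\<close>
  have inj: "inj_on h I'"
  proof (rule inj_onI, rule ccontr)
    fix i j assume ij: "i \<in> I'" "j \<in> I'" "h i = h j" "i \<noteq> j"
    then have "{cl (fst i)<..<cl (snd i)} = {}" using disj[of i j] by (auto simp: h_def)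
    then show False using ij by (auto simp: I'_def)
  qed
  have "nonoverlapping p q (h ` I')"
    unfolding nonoverlapping_def
  proof (intro conjI)
    show "finite (h ` I')" using fin by simp
    show "\<forall>i\<in>h ` I'. p \<le> fst i \<and> fst i < snd i \<and> snd i \<le> q"
      using assms(2) by (auto simp: h_def I'_def) (auto simp: cl_def)
    show "disjoint_family_on (\<lambda>p. {fst p<..<snd p}) (h ` I')"
      unfolding disjoint_family_on_def
    proof (intro ballI impI)
      fix p q assume "p \<in> h ` I'" "q \<in> h ` I'" "p \<noteq> q"
      then obtain i j where "i \<in> I'" "j \<in> I'" "i \<noteq> j" "p = h i" "q = h j" by blast
      then show "{fst p<..<snd p} \<inter> {fst q<..<snd q} = {}" using disj[of i j] by (simp add: h_def)
    qed
  qed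
  moreover have "increments f (h ` I') = (\<Sum>i\<in>I. \<bar>f (cl (snd i)) - f (cl (fst i))\<bar>)" for f
  proof -
    have "increments f (h ` I') = (\<Sum>i\<in>I'. \<bar>f (cl (snd i)) - f (cl (fst i))\<bar>)"
      unfolding increments_def sum.reindex[OF inj] by (simp add: h_def)
    also have "\<dots> = (\<Sum>i\<in>I. \<bar>f (cl (snd i)) - f (cl (fst i))\<bar>)"
    proof (rule sum.mono_neutral_left)
      show "\<forall>i\<in>I - I'. \<bar>f (cl (snd i)) - f (cl (fst i))\<bar> = 0"
      proof
        fix i assume i: "i \<in> I - I'"
        then have "fst i < snd i" using assms(1) by (auto simp: nonoverlapping_def)
        then have "cl (fst i) = cl (snd i)" using i mono[of "fst i" "snd i"] by (auto simp: I'_def)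
        then show "\<bar>f (cl (snd i)) - f (cl (fst i))\<bar> = 0" by simp
      qed
    qed (use fin in \<open>auto simp: I'_def\<close>)
    finally show ?thesis .
  qed
  ultimately show ?thesis using that unfolding cl_def by blast
qed

text \<open>The family is clamped to \<open>{a..m}\<close> and to \<open>{m..b}\<close>. An interval
  straddling \<open>m\<close> is cut in two, and the triangle inequality there gives
  \<open>\<le>\<close>.\<close>

lemma nonoverlapping_split:
  assumes "nonoverlapping a b I" "a \<le> m" "m \<le> b"
  obtains J K where "nonoverlapping a m J" "nonoverlapping m b K"
    "\<And>f. increments f I \<le> increments f J + increments f K"
proof -
  obtain J where J: "nonoverlapping a m J"
    "\<And>f. increments f J = (\<Sum>i\<in>I. \<bar>f (max a (min m (snd i))) - f (max a (min m (fst i)))\<bar>)"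
    using nonoverlapping_clamp[OF assms(1,2)] by blast
  obtain K where K: "nonoverlapping m b K"
    "\<And>f. increments f K = (\<Sum>i\<in>I. \<bar>f (max m (min b (snd i))) - f (max m (min b (fst i)))\<bar>)"
    using nonoverlapping_clamp[OF assms(1,3)] by blast
  have "increments f I \<le> increments f J + increments f K" for f
    unfolding J(2) K(2) sum.distrib[symmetric] unfolding increments_def
  proof (rule sum_mono)
    fix i assume "i \<in> I"
    then have i: "a \<le> fst i" "fst i < snd i" "snd i \<le> b" using assms(1) by (auto simp: nonoverlapping_def)
    consider "snd i \<le> m" | "fst i \<le> m" "m < snd i" | "m < fst i" by linarith
    then show "\<bar>f (snd i) - f (fst i)\<bar> \<le> \<bar>f (max a (min m (snd i))) - f (max a (min m (fst i)))\<bar>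
        + \<bar>f (max m (min b (snd i))) - f (max m (min b (fst i)))\<bar>"
      using i assms(2,3) by cases (simp_all add: max_absorb1 max_absorb2 min_absorb1 min_absorb2)
  qed
  then show ?thesis using that J(1) K(1) by blast
qed

text \<open>Absolute continuity with tolerance 1 bounds the increments by 1 on any piece shorter
  than \<open>d\<close>, and finitely many such pieces exhaust \<open>{a..b}\<close>.\<close>

lemma ac_real_bounded_increments:
  assumes "ac_real a b f"
  shows "\<exists>M. \<forall>I. nonoverlapping a b I \<longrightarrow> increments f I \<le> M"
proof (cases "a \<le> b")
  case False
  then have "I = {}" if "nonoverlapping a b I" for I
    using that by (fastforce simp: nonoverlapping_def)
  then show ?thesis by (metis increments_empty order_refl)
next
  case ab: True
  obtain d where d: "d > 0" "\<And>I. nonoverlapping a b I \<Longrightarrow> increments id I < d \<Longrightarrow> increments f I < 1"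
    using assms unfolding ac_real_def by (metis zero_less_one)
  \<comment> \<open>Steps of \<open>d/2\<close> keep each new piece strictly shorter than
    \<open>d\<close>; \<open>min b\<close> stops the sweep at the right endpoint. Each step adds 1
    to the bound.\<close>
  have step: "\<exists>M. \<forall>I. nonoverlapping a (min b (a + real n * (d/2))) I \<longrightarrow> increments f I \<le> M" for n
  proof (induction n)
    case 0
    then have "I = {}" if "nonoverlapping a a I" for I
      using that by (fastforce simp: nonoverlapping_def)
    moreover have "min b (a + real 0 * (d/2)) = a" using ab by simp
    ultimately show ?case by (metis increments_empty order_refl)
  next
    case (Suc n)
    define m where "m = min b (a + real n * (d/2))"
    define m' where "m' = min b (a + real (Suc n) * (d/2))"
    have m: "a \<le> m" "m \<le> m'" "m' \<le> b" "m' - m < d"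
    proof -
      have "real (Suc n) * (d/2) = real n * (d/2) + d/2" by (simp add: field_simps)
      moreover have "0 \<le> real n * (d/2)" using d(1) by simp
      ultimately show "a \<le> m" "m \<le> m'" "m' \<le> b" "m' - m < d"
        using d(1) ab unfolding m_def m'_def by linarith+
    qed
    obtain M where M: "\<And>I. nonoverlapping a m I \<Longrightarrow> increments f I \<le> M"
      using Suc.IH unfolding m_def by blast
    have "increments f I \<le> M + 1" if I: "nonoverlapping a m' I" for I
    proof -
      obtain J K where JK: "nonoverlapping a m J" "nonoverlapping m m' K"
        "increments f I \<le> increments f J + increments f K"
        using nonoverlapping_split[OF I m(1,2)] by metis
      have "increments f K < 1"
        using increments_id_le[OF JK(2) m(2)] m nonoverlapping_mono[OF JK(2) m(1,3)] by (intro d(2)) auto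
      then show ?thesis using JK M[OF JK(1)] by linarith
    qed
    then show ?case unfolding m'_def by blast
  qed
  obtain n :: nat where n: "(b - a) / (d/2) < real n" using reals_Archimedean2 by blast
  then have "b \<le> a + real n * (d/2)" using d(1) by (simp add: field_simps)
  then show ?thesis using step[of n] by (simp add: min_def)
qed

lemma nonoverlapping_UN:
  assumes "finite A" "\<And>i. i \<in> A \<Longrightarrow> nonoverlapping (u i) (w i) (J i)"
    "\<And>i. i \<in> A \<Longrightarrow> a \<le> u i \<and> w i \<le> b" "disjoint_family_on (\<lambda>i. {u i<..<w i}) A"
  shows "nonoverlapping a b (\<Union>i\<in>A. J i)" "increments f (\<Union>i\<in>A. J i) = (\<Sum>i\<in>A. increments f (J i))"
proof -
  have sub: "{fst p<..<snd p} \<subseteq> {u i<..<w i}" "fst p < snd p" if "i \<in> A" "p \<in> J i" for i p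
    using assms(2)[OF that(1)] that(2) by (auto simp: nonoverlapping_def)
  have dis: "{fst p<..<snd p} \<inter> {fst q<..<snd q} = {}" 
    if "i \<in> A" "p \<in> J i" "j \<in> A" "q \<in> J j" "i \<noteq> j" for i j p q
    using sub[OF that(1,2)] sub[OF that(3,4)] assms(4) that unfolding disjoint_family_on_def by blast
  have "disjoint_family_on (\<lambda>p. {fst p<..<snd p}) (\<Union>i\<in>A. J i)"
    unfolding disjoint_family_on_def
  proof (intro ballI impI)
    fix p q assume pq: "p \<in> (\<Union>i\<in>A. J i)" "q \<in> (\<Union>i\<in>A. J i)" "p \<noteq> q"
    then obtain i j where ij: "i \<in> A" "p \<in> J i" "j \<in> A" "q \<in> J j" by blast
    show "{fst p<..<snd p} \<inter> {fst q<..<snd q} = {}"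
    proof (cases "i = j")
      case True
      then show ?thesis using assms(2)[OF ij(1)] ij pq(3)
        unfolding nonoverlapping_def disjoint_family_on_def by blast
    next
      case False
      then show ?thesis using dis ij by blast
    qed
  qed
  moreover have "finite (\<Union>i\<in>A. J i)" using assms(1,2) by (auto simp: nonoverlapping_def)
  moreover have "\<forall>p\<in>(\<Union>i\<in>A. J i). a \<le> fst p \<and> fst p < snd p \<and> snd p \<le> b"
    using assms(2,3) unfolding nonoverlapping_def by fastforce
  ultimately show "nonoverlapping a b (\<Union>i\<in>A. J i)" by (simp add: nonoverlapping_def)
  show "increments f (\<Union>i\<in>A. J i) = (\<Sum>i\<in>A. increments f (J i))"
    unfolding increments_def
  proof (rule sum.UNION_disjoint)
    show "\<forall>i\<in>A. \<forall>j\<in>A. i \<noteq> j \<longrightarrow> J i \<inter> J j = {}"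
    proof (intro ballI impI)
      fix i j assume ij: "i \<in> A" "j \<in> A" "i \<noteq> j"
      have False if "p \<in> J i" "p \<in> J j" for p
        using dis[OF ij(1) that(1) ij(2) that(2) ij(3)] sub(2)[OF ij(1) that(1)] by simp
      then show "J i \<inter> J j = {}" by blast
    qed
  qed (use assms(1,2) in \<open>auto simp: nonoverlapping_def\<close>)
qed

section \<open>Total variation as a function of the right endpoint\<close>

context
  fixes a b :: real and f :: "real \<Rightarrow> real"
  assumes ac: "ac_real a b f"
begin

lemma increments_le_variation:
  assumes "nonoverlapping s t I" "a \<le> s" "t \<le> b"
  shows "increments f I \<le> variation f s t"
proof -
  obtain M where "\<And>I. nonoverlapping a b I \<Longrightarrow> increments f I \<le> M"
    using ac_real_bounded_increments[OF ac] by blast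
  then have "bdd_above (increments f ` {I. nonoverlapping s t I})"
    using nonoverlapping_mono[OF _ assms(2,3)] by (auto simp: bdd_above_def)
  then show ?thesis
    unfolding variation_def using assms(1) by (intro cSUP_upper) auto
qed

text \<open>Adding \<open>(s, t)\<close> to a family in \<open>{a..s}\<close> gives a family in
  \<open>{a..t}\<close>. This makes both the variation and its difference with \<open>f\<close>
  increasing.\<close>

lemma variation_superadditive:
  assumes "a \<le> s" "s < t" "t \<le> b"
  shows "variation f a s + \<bar>f t - f s\<bar> \<le> variation f a t"
proof -
  have "variation f a s \<le> variation f a t - \<bar>f t - f s\<bar>"
    unfolding variation_def[of f a s]
  proof (rule cSUP_least)
    fix I assume "I \<in> {I. nonoverlapping a s I}"
    then have I: "nonoverlapping a s I" by simp
    \<comment> \<open>The two families are indexed by a Boolean so that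
      \<open>nonoverlapping_UN\<close> covers their union.\<close>
    let ?J = "\<lambda>c. if c then I else {(s, t)}"
    have J: "nonoverlapping a t (\<Union>c\<in>UNIV. ?J c)"
      "increments f (\<Union>c\<in>UNIV. ?J c) = (\<Sum>c\<in>UNIV. increments f (?J c))"
    proof -
      have 1: "nonoverlapping (if c then a else s) (if c then s else t) (?J c)" for c
        using I assms nonoverlapping_single[of s s t t] by simp
      have 2: "a \<le> (if c then a else s) \<and> (if c then s else t) \<le> t" for c using assms by simp
      have 3: "disjoint_family_on (\<lambda>c. {(if c then a else s)<..<(if c then s else t)}) UNIV"
        using assms by (auto simp: disjoint_family_on_def)
      show "nonoverlapping a t (\<Union>c\<in>UNIV. ?J c)"
        "increments f (\<Union>c\<in>UNIV. ?J c) = (\<Sum>c\<in>UNIV. increments f (?J c))"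
        using nonoverlapping_UN[OF finite 1 2 3] by blast+
    qed
    show "increments f I \<le> variation f a t - \<bar>f t - f s\<bar>"
      using increments_le_variation[OF J(1)] J(2) assms by (simp add: UNIV_bool)
  qed (auto intro: exI[of _ "{}"])
  then show ?thesis by simp
qed

lemma variation_subadditive:
  assumes "a \<le> s" "s \<le> t" "t \<le> b"
  shows "variation f a t \<le> variation f a s + variation f s t"
  unfolding variation_def[of f a t]
proof (rule cSUP_least)
  fix I assume "I \<in> {I. nonoverlapping a t I}"
  then obtain J K where JK: "nonoverlapping a s J" "nonoverlapping s t K"
    "increments f I \<le> increments f J + increments f K"
    using nonoverlapping_split[of a t I s] assms by (metis mem_Collect_eq)
  then show "increments f I \<le> variation f a s + variation f s t"
    using increments_le_variation[OF JK(1)] increments_le_variation[OF JK(2)] assms by linarith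
qed (auto intro: exI[of _ "{}"])

lemma mono_on_variation: "mono_on {a..b} (variation f a)"
proof (rule mono_onI)
  fix s t assume "s \<in> {a..b}" "t \<in> {a..b}" "s \<le> t"
  then show "variation f a s \<le> variation f a t"
    using variation_superadditive[of s t] by (cases "s = t") auto
qed

text \<open>Each interval of \<open>I\<close> contains a family that almost attains the variation of
  \<open>f\<close> over it. Together these families are no longer than \<open>I\<close>, so absolute
  continuity of \<open>f\<close> bounds their increments by \<open>e/2\<close>; the defects add up
  to at most another \<open>e/2\<close>.\<close>

lemma ac_real_variation: "ac_real a b (variation f a)"
  unfolding ac_real_def
proof (intro allI impI)
  fix e :: real assume e: "e > 0"
  then obtain d where d: "d > 0" "\<And>I. nonoverlapping a b I \<Longrightarrow> increments id I < d \<Longrightarrow> increments f I < e/2"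
    using ac unfolding ac_real_def by (metis half_gt_zero)
  have "increments (variation f a) I < e" if I: "nonoverlapping a b I" "increments id I < d" for I
  proof -
    have fin: "finite I" using I by (simp add: nonoverlapping_def)
    have bd: "a \<le> fst p" "fst p < snd p" "snd p \<le> b" if "p \<in> I" for p
      using I that by (auto simp: nonoverlapping_def)
    \<comment> \<open>The defect allowed per interval; the 1 in the denominator covers the empty
      family.\<close>
    define \<eta> where "\<eta> = e / (2 * (real (card I) + 1))"
    have \<eta>: "\<eta> > 0" using e by (simp add: \<eta>_def)
    have "\<exists>J. nonoverlapping (fst p) (snd p) J \<and> variation f (fst p) (snd p) - \<eta> < increments f J" for p
    proof -
      have "variation f (fst p) (snd p) - \<eta> < variation f (fst p) (snd p)" using \<eta> by simp
      then have "\<exists>J\<in>{J. nonoverlapping (fst p) (snd p) J}. variation f (fst p) (snd p) - \<eta> < increments f J"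
        unfolding variation_def
        by (metis (no_types, lifting) cSUP_least empty_iff mem_Collect_eq nonoverlapping_empty not_less)
      then show ?thesis by blast
    qed
    then obtain J where J: "\<And>p. nonoverlapping (fst p) (snd p) (J p)"
      "\<And>p. variation f (fst p) (snd p) - \<eta> < increments f (J p)" by metis
    have U: "nonoverlapping a b (\<Union>p\<in>I. J p)" "increments h (\<Union>p\<in>I. J p) = (\<Sum>p\<in>I. increments h (J p))" for h
      using I J(1) by (intro nonoverlapping_UN[where u=fst and w=snd]; auto simp: nonoverlapping_def)+
    have "increments id (\<Union>p\<in>I. J p) \<le> increments id I"
      unfolding U(2) increments_id[OF I(1)] using increments_id_le[OF J(1)] bd by (intro sum_mono) force
    then have lt: "(\<Sum>p\<in>I. increments f (J p)) < e/2" using d(2)[OF U(1)] I(2) U(2) by simp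
    have "increments (variation f a) I \<le> (\<Sum>p\<in>I. increments f (J p) + \<eta>)"
      unfolding increments_def[of "variation f a"]
    proof (rule sum_mono)
      fix p assume p: "p \<in> I"
      \<comment> \<open>Superadditivity shows that the difference is nonnegative; subadditivity
        bounds it by the variation over the interval itself.\<close>
      show "\<bar>variation f a (snd p) - variation f a (fst p)\<bar> \<le> increments f (J p) + \<eta>"
        using variation_superadditive[of "fst p" "snd p"] variation_subadditive[of "fst p" "snd p"] J(2)[of p] bd[OF p]
        by linarith
    qed
    also have "\<dots> = (\<Sum>p\<in>I. increments f (J p)) + real (card I) * \<eta>" by (simp add: sum.distrib)
    also have "real (card I) * \<eta> \<le> e/2" using e by (simp add: \<eta>_def field_simps)
    finally show ?thesis using lt by linarith
  qed
  then show "\<exists>d>0. \<forall>I. nonoverlapping a b I \<and> increments id I < d \<longrightarrow> increments (variation f a) I < e"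
    using d(1) by blast
qed

end

section \<open>Jordan decomposition of absolutely continuous functions\<close>

lemma ac_real_diff:
  assumes "ac_real a b f" "ac_real a b g"
  shows "ac_real a b (\<lambda>t. f t - g t)"
  unfolding ac_real_def
proof (intro allI impI)
  fix e :: real assume "e > 0"
  then have "e/2 > 0" by simp
  then obtain d d' where d: "d > 0" "\<And>I. nonoverlapping a b I \<Longrightarrow> increments id I < d \<Longrightarrow> increments f I < e/2"
    "d' > 0" "\<And>I. nonoverlapping a b I \<Longrightarrow> increments id I < d' \<Longrightarrow> increments g I < e/2"
    using assms unfolding ac_real_def by metis
  have le: "increments (\<lambda>t. f t - g t) I \<le> increments f I + increments g I" for I
    unfolding increments_def sum.distrib[symmetric] by (intro sum_mono) linarith
  have "increments (\<lambda>t. f t - g t) I < e" if "nonoverlapping a b I" "increments id I < min d d'" for I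
    using d(2)[OF that(1)] d(4)[OF that(1)] that(2) le[of I] by linarith
  then show "\<exists>d>0. \<forall>I. nonoverlapping a b I \<and> increments id I < d \<longrightarrow> increments (\<lambda>t. f t - g t) I < e"
    using d(1,3) by (intro exI[of _ "min d d'"]) auto
qed

lemma ac_real_jordan:
  assumes "ac_real a b f"
  obtains g h where "ac_real a b g" "mono_on {a..b} g" "ac_real a b h" "mono_on {a..b} h" "\<And>t. f t = g t - h t"
proof
  let ?g = "variation f a"
  show "ac_real a b ?g" "mono_on {a..b} ?g"
    using ac_real_variation[OF assms] mono_on_variation[OF assms] .
  show "ac_real a b (\<lambda>t. ?g t - f t)"
    using ac_real_diff[OF ac_real_variation[OF assms] assms] .
  show "mono_on {a..b} (\<lambda>t. ?g t - f t)"
  proof (rule mono_onI)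
    fix s t assume "s \<in> {a..b}" "t \<in> {a..b}" "s \<le> t"
    then show "variation f a s - f s \<le> variation f a t - f t"
      using variation_superadditive[OF assms, of s t] by (cases "s = t") auto
  qed
qed simp

lemma ac_real_continuous_on:
  assumes "ac_real a b f"
  shows "continuous_on {a..b} f"
  unfolding continuous_on_iff
proof (intro ballI allI impI)
  fix t e :: real assume t: "t \<in> {a..b}" and "e > 0"
  then obtain d where d: "d > 0" "\<And>I. nonoverlapping a b I \<Longrightarrow> increments id I < d \<Longrightarrow> increments f I < e"
    using assms unfolding ac_real_def by metis
  have "dist (f s) (f t) < e" if "s \<in> {a..b}" "dist s t < d" for s
  proof (cases s t rule: linorder_cases)
    case less
    then show ?thesis using d(2)[OF nonoverlapping_single[of a s t b]] that t by (auto simp: dist_real_def)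
  next
    case greater
    then show ?thesis using d(2)[OF nonoverlapping_single[of a t s b]] that t by (auto simp: dist_real_def)
  qed (use \<open>e > 0\<close> in auto)
  then show "\<exists>d>0. \<forall>s\<in>{a..b}. dist s t < d \<longrightarrow> dist (f s) (f t) < e" using d(1) by blast
qed

section \<open>Differentiation of indefinite integrals\<close>

text \<open>A negligible set is Lebesgue null but possibly not Borel; a Borel null set containing it
  serves as witness.\<close>

lemma negligible_imp_AE_lborel:
  assumes "negligible S"
  shows "AE t in lborel. t \<notin> S"
proof -
  have "S \<in> null_sets lebesgue" using assms by (simp add: negligible_iff_null_sets)
  then obtain N where "N \<in> null_sets lborel" "S \<subseteq> N"
    unfolding null_sets_completion_iff2 by blast
  then show ?thesis by (intro AE_I'[of N]) auto
qed

text \<open>The finite measure \<open>\<mu>\<close> with density \<open>g\<close> vanishes on the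
  zero set of \<open>g\<close>, so by outer regularity that set lies in an open \<open>U\<close> of
  tiny \<open>\<mu>\<close>-mass. Points violating the estimate are covered, in the sense of Vitali,
  by intervals in \<open>U\<close> whose length is controlled by their \<open>\<mu>\<close>-mass; a
  disjoint selection covers almost all of them and has small total length.\<close>

lemma AE_zero_density:
  fixes g :: "real \<Rightarrow> real"
  assumes g: "integrable lborel g" and nonneg: "\<And>u. 0 \<le> g u"
  shows "AE t in lborel. g t = 0 \<longrightarrow> (\<forall>e>0. \<exists>d>0. \<forall>s s'. s \<le> t \<and> t \<le> s' \<and> s < s' \<and> s' - s < d
           \<longrightarrow> (LINT u:{s..s'}|lborel. g u) \<le> e * (s' - s))"
proof -
  have [measurable]: "g \<in> borel_measurable borel" using g by auto
  define \<mu> where "\<mu> = density lborel (\<lambda>u. ennreal (g u))"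
  have sets_\<mu> [measurable_cong, simp]: "sets \<mu> = sets borel" by (simp add: \<mu>_def)
  have \<mu>_eq: "emeasure \<mu> A = ennreal (LINT u:A|lborel. g u)" if [measurable]: "A \<in> sets borel" for A
  proof -
    have "emeasure \<mu> A = (\<integral>\<^sup>+u. ennreal (indicator A u *\<^sub>R g u) \<partial>lborel)"
      unfolding \<mu>_def by (auto simp: emeasure_density intro!: nn_integral_cong split: split_indicator)
    also have "\<dots> = ennreal (LINT u:A|lborel. g u)"
      unfolding set_lebesgue_integral_def
    proof (rule nn_integral_eq_integral)
      show "integrable lborel (\<lambda>u. indicator A u *\<^sub>R g u)" using g by (intro integrable_mult_indicator) auto
    qed (simp add: nonneg)
    finally show ?thesis .
  qed
  \<comment> \<open>\<open>S k\<close> is the set of zeros of \<open>g\<close> lying in arbitrarily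
    short intervals on which the mean of \<open>g\<close> exceeds \<open>1 / Suc k\<close>.\<close>
  define S where "S = (\<lambda>k::nat. {t. g t = 0 \<and> (\<forall>d>0. \<exists>s s'. s \<le> t \<and> t \<le> s' \<and> s < s' \<and> s' - s < d \<and>
    s' - s < real (Suc k) * (LINT u:{s..s'}|lborel. g u))})"
  have "negligible (S k)" for k
    unfolding negligible_outer_le
  proof (intro allI impI)
    fix e :: real assume e: "e > 0"
    define B where "B = {t. g t = 0}"
    have [measurable]: "B \<in> sets borel" unfolding B_def by measurable
    have "emeasure \<mu> B = 0"
      unfolding \<mu>_def by (auto simp: emeasure_density B_def nn_integral_0_iff_AE split: split_indicator)
    moreover have "emeasure \<mu> B = (INF U \<in> {U. B \<subseteq> U \<and> open U}. emeasure \<mu> U)"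
      using \<mu>_eq[of UNIV] by (intro outer_regular) (auto simp: \<mu>_def)
    ultimately have "(INF U \<in> {U. B \<subseteq> U \<and> open U}. emeasure \<mu> U) < ennreal (e / real (Suc k))"
      using e by simp
    then obtain U where U: "B \<subseteq> U" "open U" "emeasure \<mu> U < ennreal (e / real (Suc k))"
      unfolding INF_less_iff by blast
    define K where "K = {(c, r). 0 < r \<and> cball c r \<subseteq> U \<and> 2 * r < real (Suc k) * (LINT u:cball c r|lborel. g u)}"
    obtain C where C: "countable C" "C \<subseteq> K"
      "pairwise (\<lambda>i j. disjnt (cball (fst i) (snd i)) (cball (fst j) (snd j))) C"
      "negligible (S k - (\<Union>i\<in>C. cball (fst i) (snd i)))"
    proof (rule Vitali_covering_theorem_cballs[of K snd "S k" fst])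
      show "\<And>i. i \<in> K \<Longrightarrow> 0 < snd i" by (auto simp: K_def)
      fix t d :: real assume t: "t \<in> S k" and d: "0 < d"
      then have "t \<in> U" using U(1) by (auto simp: S_def B_def)
      then obtain \<delta> where \<delta>: "\<delta> > 0" "ball t \<delta> \<subseteq> U" using U(2) open_contains_ball by blast
      have "min d \<delta> > 0" using d \<delta>(1) by simp
      moreover have "\<forall>d>0. \<exists>s s'. s \<le> t \<and> t \<le> s' \<and> s < s' \<and> s' - s < d \<and>
          s' - s < real (Suc k) * (LINT u:{s..s'}|lborel. g u)"
        using t unfolding S_def by blast
      ultimately obtain s s' where s: "s \<le> t" "t \<le> s'" "s < s'" "s' - s < min d \<delta>"
        "s' - s < real (Suc k) * (LINT u:{s..s'}|lborel. g u)"
        by blast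
      \<comment> \<open>Vitali's theorem speaks of balls, so the interval is rewritten about its
        midpoint; \<open>t\<close> need not be the centre.\<close>
      have cb: "cball ((s + s')/2) ((s' - s)/2) = {s..s'}"
        by (auto simp: cball_eq_atLeastAtMost field_simps)
      have "{s..s'} \<subseteq> ball t \<delta>" using s by (auto simp: dist_real_def)
      then show "\<exists>i. i \<in> K \<and> t \<in> cball (fst i) (snd i) \<and> snd i < d"
        using s \<delta>(2) by (intro exI[of _ "((s + s')/2, (s' - s)/2)"]) (auto simp: K_def cb)
    qed blast
    define W where "W = (\<Union>i\<in>C. cball (fst i) (snd i))"
    have [measurable]: "W \<in> sets borel" unfolding W_def using C(1) by (intro sets.countable_UN') auto
    have disj: "disjoint_family_on (\<lambda>i. cball (fst i) (snd i)) C"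
      using C(3) by (simp add: disjoint_family_on_def pairwise_def disjnt_def)
    have "emeasure lborel W = (\<integral>\<^sup>+i. emeasure lborel (cball (fst i) (snd i)) \<partial>count_space C)"
      unfolding W_def using C(1) disj by (intro emeasure_UN_countable) auto
    \<comment> \<open>Membership in \<open>K\<close> bounds the length of each ball by
      \<open>Suc k\<close> times its \<open>\<mu>\<close>-mass.\<close>
    also have "\<dots> \<le> (\<integral>\<^sup>+i. ennreal (real (Suc k)) * emeasure \<mu> (cball (fst i) (snd i)) \<partial>count_space C)"
    proof (rule nn_integral_mono)
      fix i assume "i \<in> space (count_space C)"
      then have "i \<in> K" using C(2) by auto
      then have i: "0 < snd i" "2 * snd i < real (Suc k) * (LINT u:cball (fst i) (snd i)|lborel. g u)"
        by (auto simp: K_def)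
      have "emeasure lborel (cball (fst i) (snd i)) = ennreal (2 * snd i)"
        using i(1) by (simp add: cball_eq_atLeastAtMost)
      also have "\<dots> \<le> ennreal (real (Suc k)) * ennreal (LINT u:cball (fst i) (snd i)|lborel. g u)"
        using i(2) by (subst ennreal_mult'[symmetric]) (auto intro!: ennreal_leI)
      finally show "emeasure lborel (cball (fst i) (snd i)) \<le> ennreal (real (Suc k)) * emeasure \<mu> (cball (fst i) (snd i))"
        by (simp add: \<mu>_eq)
    qed
    also have "\<dots> = ennreal (real (Suc k)) * (\<integral>\<^sup>+i. emeasure \<mu> (cball (fst i) (snd i)) \<partial>count_space C)"
      by (rule nn_integral_cmult) simp
    also have "(\<integral>\<^sup>+i. emeasure \<mu> (cball (fst i) (snd i)) \<partial>count_space C) = emeasure \<mu> W"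
      unfolding W_def using C(1) disj by (intro emeasure_UN_countable[symmetric]) auto
    also have "emeasure \<mu> W \<le> emeasure \<mu> U"
    proof (rule emeasure_mono)
      show "W \<subseteq> U" using C(2) unfolding W_def K_def by fastforce
    qed (use U(2) in simp)
    also have "\<dots> \<le> ennreal (e / real (Suc k))" using U(3) by simp
    finally have "emeasure lborel W \<le> ennreal (real (Suc k)) * ennreal (e / real (Suc k))"
      by (simp add: mult_left_mono)
    also have "\<dots> = ennreal e" using e by (subst ennreal_mult[symmetric]) (auto simp del: of_nat_Suc)
    finally have W: "emeasure lborel W \<le> ennreal e" .
    then have Wf: "W \<in> fmeasurable lborel" 
      by (intro fmeasurableI) (auto simp: le_less_trans[OF _ ennreal_less_top])
    have Wl: "W \<in> lmeasurable" using Wf by (simp add: lmeasurable_iff_integrable fmeasurable_def)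
    have "measure lebesgue W \<le> e"
      using W e by (simp add: measure_def enn2real_leI)
    then have "measure lebesgue ((S k - W) \<union> W) \<le> e"
      using measure_Un_le[of "S k - W" lebesgue W] C(4) Wl negligible_imp_measure0[of "S k - W"]
        negligible_imp_sets[of "S k - W"]
      unfolding W_def[symmetric] by (simp add: fmeasurableD)
    then show "\<exists>T. S k \<subseteq> T \<and> T \<in> lmeasurable \<and> measure lebesgue T \<le> e"
      using C(4) Wl negligible_imp_measurable[of "S k - W"] unfolding W_def[symmetric]
      by (intro exI[of _ "(S k - W) \<union> W"]) (auto simp del: Un_Diff_cancel2 intro: fmeasurable.Un)
  qed
  then have "negligible (\<Union>k. S k)" by (intro negligible_countable_Union) auto
  then have "AE t in lborel. t \<notin> (\<Union>k. S k)" by (rule negligible_imp_AE_lborel)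
  then show ?thesis
  proof (rule AE_mp, intro AE_I2 impI allI)
    fix t e :: real assume t: "t \<notin> (\<Union>k. S k)" "g t = 0" and e: "0 < e"
    obtain k where k: "1 / real (Suc k) < e" using nat_approx_posE[OF e] by blast
    have "\<not> (\<forall>d>0. \<exists>s s'. s \<le> t \<and> t \<le> s' \<and> s < s' \<and> s' - s < d \<and>
        s' - s < real (Suc k) * (LINT u:{s..s'}|lborel. g u))"
      using t unfolding S_def by blast
    then obtain d where d: "d > 0" "\<And>s s'. s \<le> t \<Longrightarrow> t \<le> s' \<Longrightarrow> s < s' \<Longrightarrow> s' - s < d \<Longrightarrow>
        real (Suc k) * (LINT u:{s..s'}|lborel. g u) \<le> s' - s"
      unfolding not_all not_imp not_ex de_Morgan_conj not_less[symmetric] by blast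
    have "(LINT u:{s..s'}|lborel. g u) \<le> e * (s' - s)" if "s \<le> t" "t \<le> s'" "s < s'" "s' - s < d" for s s'
    proof -
      have "(LINT u:{s..s'}|lborel. g u) \<le> 1 / real (Suc k) * (s' - s)"
        using d(2)[OF that] by (simp add: field_simps del: of_nat_Suc)
      also have "\<dots> \<le> e * (s' - s)" using k that by (intro mult_right_mono) auto
      finally show ?thesis .
    qed
    then show "\<exists>d>0. \<forall>s s'. s \<le> t \<and> t \<le> s' \<and> s < s' \<and> s' - s < d \<longrightarrow> (LINT u:{s..s'}|lborel. g u) \<le> e * (s' - s)"
      using d(1) by blast
  qed
qed

text \<open>For a rational \<open>p\<close> just above \<open>f t\<close>, the excess
  \<open>g p\<close> of \<open>f\<close> over \<open>p\<close> vanishes at \<open>t\<close>, so its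
  means near \<open>t\<close> are small by \<open>AE_zero_density\<close>, while \<open>f\<close> is
  at most \<open>p + g p\<close> on \<open>{a..b}\<close>. Rational levels keep the exceptional sets
  countable in number; cutting off to \<open>{a..b}\<close> makes the excess integrable.\<close>

lemma AE_upper_derivative_integral:
  fixes f :: "real \<Rightarrow> real"
  assumes f: "integrable lborel f"
  shows "AE t in lborel. t \<in> {a<..<b} \<longrightarrow> (\<forall>e>0. \<exists>d>0. \<forall>s s'. a \<le> s \<and> s \<le> t \<and> t \<le> s' \<and> s' \<le> b \<and> s < s' \<and> s' - s < d
           \<longrightarrow> (LINT u:{s..s'}|lborel. f u) \<le> (f t + e) * (s' - s))"
proof -
  have [measurable]: "f \<in> borel_measurable borel" using f by auto
  define g where "g = (\<lambda>(p::rat) u. indicator {a..b} u *\<^sub>R max 0 (f u - of_rat p))"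
  have int_g: "integrable lborel (g p)" for p
  proof -
    have "set_integrable lborel {a..b} (\<lambda>u. f u - of_rat p)"
    proof (rule set_integral_diff(1))
      show "set_integrable lborel {a..b} f" using f unfolding set_integrable_def by (intro integrable_mult_indicator) auto
      show "set_integrable lborel {a..b} (\<lambda>u. real_of_rat p)"
        unfolding set_integrable_def
        by (intro integrable_scaleR_left integrable_real_indicator) (auto simp: emeasure_lborel_Icc_eq)
    qed
    then have "integrable lborel (\<lambda>u. max 0 (indicator {a..b} u *\<^sub>R (f u - of_rat p)))"
      unfolding set_integrable_def by (intro integrable_max) auto
    then show ?thesis
      by (rule Bochner_Integration.integrable_cong[THEN iffD1, rotated -1]) (auto simp: g_def split: split_indicator)
  qed
  have "AE t in lborel. \<forall>p. g p t = 0 \<longrightarrow> (\<forall>e>0. \<exists>d>0. \<forall>s s'. s \<le> t \<and> t \<le> s' \<and> s < s' \<and> s' - s < d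
           \<longrightarrow> (LINT u:{s..s'}|lborel. g p u) \<le> e * (s' - s))"
    unfolding AE_all_countable using int_g by (intro allI AE_zero_density) (auto simp: g_def)
  then show ?thesis
  proof (rule AE_mp, intro AE_I2 impI allI)
    fix t e :: real
    assume *: "\<forall>p. g p t = 0 \<longrightarrow> (\<forall>e>0. \<exists>d>0. \<forall>s s'. s \<le> t \<and> t \<le> s' \<and> s < s' \<and> s' - s < d
           \<longrightarrow> (LINT u:{s..s'}|lborel. g p u) \<le> e * (s' - s))"
      and t: "t \<in> {a<..<b}" and e: "0 < e"
    obtain p where p: "f t < real_of_rat p" "real_of_rat p < f t + e/2"
      using of_rat_dense[of "f t" "f t + e/2"] e by auto
    then have "g p t = 0" by (simp add: g_def)
    then obtain d where d: "d > 0" "\<And>s s'. s \<le> t \<Longrightarrow> t \<le> s' \<Longrightarrow> s < s' \<Longrightarrow> s' - s < d \<Longrightarrow>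
        (LINT u:{s..s'}|lborel. g p u) \<le> e/2 * (s' - s)"
      using * e by (meson half_gt_zero)
    have "(LINT u:{s..s'}|lborel. f u) \<le> (f t + e) * (s' - s)"
      if s: "a \<le> s" "s \<le> t" "t \<le> s'" "s' \<le> b" "s < s'" "s' - s < d" for s s'
    proof -
      have i1: "set_integrable lborel {s..s'} (\<lambda>u. real_of_rat p)"
        unfolding set_integrable_def
        by (intro integrable_scaleR_left integrable_real_indicator) (auto simp: emeasure_lborel_Icc_eq)
      have i2: "set_integrable lborel {s..s'} (g p)" "set_integrable lborel {s..s'} f"
        unfolding set_integrable_def using int_g[of p] f by (intro integrable_mult_indicator; simp)+
      have "(LINT u:{s..s'}|lborel. f u) \<le> (LINT u:{s..s'}|lborel. real_of_rat p + g p u)"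
        using i1 i2 s by (intro set_integral_mono set_integral_add(1)) (auto simp: g_def)
      also have "\<dots> = real_of_rat p * (s' - s) + (LINT u:{s..s'}|lborel. g p u)"
        using i1 i2 s by (subst set_integral_add(2)) (auto simp: set_lebesgue_integral_def)
      also have "\<dots> \<le> (f t + e/2) * (s' - s) + e/2 * (s' - s)"
        using d(2) s p by (intro add_mono mult_right_mono) auto
      finally show ?thesis by (simp add: algebra_simps)
    qed
    then show "\<exists>d>0. \<forall>s s'. a \<le> s \<and> s \<le> t \<and> t \<le> s' \<and> s' \<le> b \<and> s < s' \<and> s' - s < d
           \<longrightarrow> (LINT u:{s..s'}|lborel. f u) \<le> (f t + e) * (s' - s)"
      using d(1) by blast
  qed
qed

text \<open>The upper estimate for \<open>-f\<close> is a lower estimate for \<open>f\<close>;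
  together they squeeze the difference quotients of \<open>F\<close>.\<close>

theorem AE_has_real_derivative_integral:
  fixes f :: "real \<Rightarrow> real"
  assumes f: "integrable lborel f"
    and F: "\<And>s t. a \<le> s \<Longrightarrow> s \<le> t \<Longrightarrow> t \<le> b \<Longrightarrow> (LINT u:{s..t}|lborel. f u) = F t - F s"
  shows "AE t in lborel. t \<in> {a<..<b} \<longrightarrow> (F has_real_derivative f t) (at t)"
  using AE_upper_derivative_integral[OF f, of a b] AE_upper_derivative_integral[of "\<lambda>u. - f u" a b, OF integrable_minus[OF f]]
proof (eventually_elim, intro impI)
  fix t assume t: "t \<in> {a<..<b}"
    and 1: "t \<in> {a<..<b} \<longrightarrow> (\<forall>e>0. \<exists>d>0. \<forall>s s'. a \<le> s \<and> s \<le> t \<and> t \<le> s' \<and> s' \<le> b \<and> s < s' \<and> s' - s < d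
           \<longrightarrow> (LINT u:{s..s'}|lborel. f u) \<le> (f t + e) * (s' - s))"
    and 2: "t \<in> {a<..<b} \<longrightarrow> (\<forall>e>0. \<exists>d>0. \<forall>s s'. a \<le> s \<and> s \<le> t \<and> t \<le> s' \<and> s' \<le> b \<and> s < s' \<and> s' - s < d
           \<longrightarrow> (LINT u:{s..s'}|lborel. - f u) \<le> (- f t + e) * (s' - s))"
  show "(F has_real_derivative f t) (at t)"
    unfolding DERIV_def
  proof (rule LIM_I)
    fix r :: real assume "0 < r"
    define e where "e = r/2"
    have e: "e > 0" "e < r" using \<open>0 < r\<close> by (auto simp: e_def)
    obtain d1 where d1: "d1 > 0" "\<And>s s'. \<lbrakk>a \<le> s; s \<le> t; t \<le> s'; s' \<le> b; s < s'; s' - s < d1\<rbrakk>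
        \<Longrightarrow> (LINT u:{s..s'}|lborel. f u) \<le> (f t + e) * (s' - s)"
      using 1 t e(1) by meson
    obtain d2 where d2: "d2 > 0" "\<And>s s'. \<lbrakk>a \<le> s; s \<le> t; t \<le> s'; s' \<le> b; s < s'; s' - s < d2\<rbrakk>
        \<Longrightarrow> (LINT u:{s..s'}|lborel. - f u) \<le> (- f t + e) * (s' - s)"
      using 2 t e(1) by meson
    have neg: "(LINT u:{s..s'}|lborel. - f u) = - (LINT u:{s..s'}|lborel. f u)" for s s'
      by (simp add: set_lebesgue_integral_def)
    define d where "d = Min {d1, d2, t - a, b - t}"
    have d: "d > 0" "d \<le> d1" "d \<le> d2" "d \<le> t - a" "d \<le> b - t" using t d1(1) d2(1) by (auto simp: d_def)
    have key: "\<bar>(F s' - F s) - f t * (s' - s)\<bar> \<le> e * (s' - s)" if "s \<le> t" "t \<le> s'" "s < s'" "s' - s < d" for s s'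
      using d1(2)[of s s'] d2(2)[of s s'] that d F[of s s'] neg[of s s'] by (simp add: algebra_simps)
    have "norm ((F (t + h) - F t) / h - f t) < r" if h: "h \<noteq> 0" "norm (h - 0) < d" for h
    proof -
      have "\<bar>F (t + h) - F t - f t * h\<bar> \<le> e * \<bar>h\<bar>"
        \<comment> \<open>The point \<open>t\<close> is the left endpoint for positive
          \<open>h\<close> and the right endpoint for negative \<open>h\<close>.\<close>
        using key[of t "t + h"] key[of "t + h" t] h by (cases "h > 0") (auto simp: algebra_simps abs_minus_commute)
      moreover have "(F (t + h) - F t) / h - f t = (F (t + h) - F t - f t * h) / h" using h by (simp add: field_simps)
      ultimately have "norm ((F (t + h) - F t) / h - f t) \<le> e" using h by (simp add: field_simps)
      then show ?thesis using e by simp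
    qed
    then show "\<exists>s>0. \<forall>x. x \<noteq> 0 \<and> norm (x - 0) < s \<longrightarrow> norm ((F (t + x) - F t) / x - f t) < r"
      using d(1) by blast
  qed
qed

section \<open>The fundamental theorem of calculus for absolutely continuous functions\<close>

lemma component_interval:
  fixes C :: "real set"
  assumes "C \<in> components U" "open U" "U \<subseteq> {a<..<b}"
  shows "a \<le> Inf C" "Inf C < Sup C" "Sup C \<le> b" "{Inf C<..<Sup C} \<subseteq> C" "C \<subseteq> {Inf C..Sup C}"
proof -
  have ne: "C \<noteq> {}" and sub: "C \<subseteq> {a<..<b}" and op: "open C" and con: "connected C"
    using assms in_components_nonempty in_components_subset open_components in_components_connected by blast+
  have bdd: "bdd_below C" "bdd_above C" using bdd_below_mono[OF _ sub] bdd_above_mono[OF _ sub] by auto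
  show "a \<le> Inf C" using ne sub by (intro cInf_greatest) auto
  show "Sup C \<le> b" using ne sub by (intro cSup_least) auto
  show CS: "C \<subseteq> {Inf C..Sup C}" using bdd by (auto intro: cInf_lower cSup_upper)
  obtain c where c: "c \<in> C" using ne by blast
  then obtain e where e: "e > 0" "ball c e \<subseteq> C" using op open_contains_ball by blast
  then have "c + e/2 \<in> C" by (auto simp: dist_real_def subset_eq)
  then show "Inf C < Sup C" using CS c e(1) by (smt (verit) atLeastAtMost_iff half_gt_zero subsetD)
  show "{Inf C<..<Sup C} \<subseteq> C"
  proof
    fix z assume "z \<in> {Inf C<..<Sup C}"
    then obtain p q where "p \<in> C" "p < z" "q \<in> C" "z < q"
      using ne bdd by (auto simp: cInf_less_iff less_cSup_iff)
    then show "z \<in> C" using connectedD_interval[OF con, of p q z] by auto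
  qed
qed

text \<open>An open set has countably many components, which are intervals. Finitely many of them
  form a nonoverlapping family of length below \<open>d\<close>, so their mass is at most
  \<open>e\<close>; this bound passes to the increasing limit.\<close>

lemma emeasure_interval_measure_open_le:
  fixes G :: "real \<Rightarrow> real"
  assumes mono: "\<And>s t. s \<le> t \<Longrightarrow> G s \<le> G t" and cont: "continuous_on UNIV G"
    and ac: "\<And>I. nonoverlapping a b I \<Longrightarrow> increments id I < d \<Longrightarrow> increments G I \<le> e"
    and U: "open U" "U \<subseteq> {a<..<b}" "emeasure lborel U < ennreal d"
  shows "emeasure (interval_measure G) U \<le> ennreal e"
proof -
  let ?\<nu> = "interval_measure G"
  define \<C> where "\<C> = components U"
  have Uc: "\<Union>\<C> = U" by (simp add: \<C>_def)
  have op: "open C" if "C \<in> \<C>" for C using that U(1) open_components by (auto simp: \<C>_def)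
  have pw: "C \<inter> C' = {}" if "C \<in> \<C>" "C' \<in> \<C>" "C \<noteq> C'" for C C'
    using that components_nonoverlap by (auto simp: \<C>_def)
  have count: "countable \<C>"
    using op pw by (intro countable_disjoint_open_subsets) (auto simp: pairwise_def disjnt_def)
  have fin: "emeasure ?\<nu> (\<Union>\<D>) \<le> ennreal e" if \<D>: "finite \<D>" "\<D> \<subseteq> \<C>" for \<D>
  proof -
    note iv = component_interval[OF _ U(1,2), folded \<C>_def]
    define p where "p = (\<lambda>C::real set. (Inf C, Sup C))"
    have disj: "{Inf C<..<Sup C} \<inter> {Inf C'<..<Sup C'} = {}" if "C \<in> \<D>" "C' \<in> \<D>" "C \<noteq> C'" for C C'
      using iv(4)[of C] iv(4)[of C'] pw[of C C'] that \<D>(2) by blast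
    have inj: "inj_on p \<D>"
    proof (rule inj_onI, rule ccontr)
      fix C C' assume *: "C \<in> \<D>" "C' \<in> \<D>" "p C = p C'" "C \<noteq> C'"
      then have "{Inf C<..<Sup C} = {}" using disj[of C C'] by (simp add: p_def)
      then show False using iv(2)[of C] * \<D>(2) by auto
    qed
    have nonov: "nonoverlapping a b (p ` \<D>)"
      unfolding nonoverlapping_def disjoint_family_on_def
    proof (intro conjI ballI impI)
      fix i assume "i \<in> p ` \<D>"
      then obtain C where "C \<in> \<C>" "i = p C" using \<D>(2) by blast
      then show "a \<le> fst i" "fst i < snd i" "snd i \<le> b" using iv[of C] by (auto simp: p_def)
    next
      fix i j assume "i \<in> p ` \<D>" "j \<in> p ` \<D>" "i \<noteq> j"
      then obtain C C' where "C \<in> \<D>" "C' \<in> \<D>" "C \<noteq> C'" "i = p C" "j = p C'" by blast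
      then show "{fst i<..<snd i} \<inter> {fst j<..<snd j} = {}" using disj[of C C'] by (simp add: p_def)
    qed (use \<D>(1) in simp)
    have "ennreal (increments id (p ` \<D>)) = (\<Sum>C\<in>\<D>. ennreal (Sup C - Inf C))"
      unfolding increments_id[OF nonov] sum.reindex[OF inj] using iv(2) \<D>(2)
      by (subst sum_ennreal) (auto simp: p_def less_imp_le)
    also have "\<dots> = (\<Sum>C\<in>\<D>. emeasure lborel {Inf C<..<Sup C})"
      using iv(2) \<D>(2) by (intro sum.cong) (auto simp: less_imp_le subset_eq)
    also have "\<dots> = emeasure lborel (\<Union>C\<in>\<D>. {Inf C<..<Sup C})"
      using \<D>(1) disj by (intro sum_emeasure) (auto simp: disjoint_family_on_def)
    also have "\<dots> \<le> emeasure lborel U"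
    proof (rule emeasure_mono)
      show "(\<Union>C\<in>\<D>. {Inf C<..<Sup C}) \<subseteq> U" using iv(4) \<D>(2) Uc by blast
    qed (use U(1) in simp)
    also have "\<dots> < ennreal d" by (rule U(3))
    finally have "increments id (p ` \<D>) < d" by (simp add: ennreal_less_iff increments_def sum_nonneg)
    then have le: "increments G (p ` \<D>) \<le> e" using ac nonov by blast
    have "emeasure ?\<nu> (\<Union>\<D>) \<le> (\<Sum>C\<in>\<D>. emeasure ?\<nu> C)"
    proof -
      have "\<D> \<subseteq> sets ?\<nu>" using \<D>(2) op by auto
      then show ?thesis using emeasure_subadditive_finite[of \<D> "\<lambda>C. C" ?\<nu>] \<D>(1) by simp
    qed
    also have "\<dots> \<le> (\<Sum>C\<in>\<D>. ennreal (G (Sup C) - G (Inf C)))"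
    proof (rule sum_mono)
      fix C assume "C \<in> \<D>"
      then have C: "Inf C < Sup C" "C \<subseteq> {Inf C..Sup C}" using iv(2,5)[of C] \<D>(2) by auto
      \<comment> \<open>Since \<open>G\<close> is continuous, the closed hull of \<open>C\<close>
        has mass exactly the increment of \<open>G\<close>.\<close>
      have "emeasure ?\<nu> C \<le> emeasure ?\<nu> {Inf C..Sup C}" using C by (intro emeasure_mono) auto
      also have "\<dots> = ennreal (G (Sup C) - G (Inf C))"
        using C mono cont by (intro emeasure_interval_measure_Icc) auto
      finally show "emeasure ?\<nu> C \<le> ennreal (G (Sup C) - G (Inf C))" .
    qed
    also have "\<dots> = ennreal (\<Sum>C\<in>\<D>. G (Sup C) - G (Inf C))"
      using iv(2) \<D>(2) mono by (intro sum_ennreal) (auto simp: less_imp_le subset_eq)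
    also have "(\<Sum>C\<in>\<D>. G (Sup C) - G (Inf C)) \<le> increments G (p ` \<D>)"
      unfolding increments_def sum.reindex[OF inj] by (intro sum_mono) (simp add: p_def)
    finally show ?thesis using le by (meson ennreal_leI order_trans)
  qed
  show ?thesis
  proof (cases "\<C> = {}")
    case True
    then show ?thesis using Uc by auto
  next
    case False
    \<comment> \<open>The enumeration \<open>from_nat_into\<close> repeats members when there are
      finitely many components; unions do not see repetitions.\<close>
    define A where "A = (\<lambda>n. \<Union>(from_nat_into \<C> ` {..<n::nat}))"
    have sub: "from_nat_into \<C> ` {..<n} \<subseteq> \<C>" for n using False by (auto intro: from_nat_into)
    have "(\<Union>n. A n) = \<Union>\<C>"
    proof
      show "\<Union>\<C> \<subseteq> (\<Union>n. A n)"
      proof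
        fix z assume "z \<in> \<Union>\<C>"
        then obtain C where C: "z \<in> C" "C \<in> \<C>" by blast
        obtain n where "from_nat_into \<C> n = C" using from_nat_into_surj[OF count C(2)] by blast
        then have "z \<in> A (Suc n)" using C(1) unfolding A_def by blast
        then show "z \<in> (\<Union>n. A n)" by blast
      qed
      show "(\<Union>n. A n) \<subseteq> \<Union>\<C>" using sub unfolding A_def by blast
    qed
    moreover have "emeasure ?\<nu> (\<Union>n. A n) = (SUP n. emeasure ?\<nu> (A n))"
    proof (rule SUP_emeasure_incseq[symmetric])
      show "range A \<subseteq> sets ?\<nu>"
      proof
        fix B assume "B \<in> range A"
        then have "open B" unfolding A_def using sub op by (auto intro!: open_Union open_UN)
        then show "B \<in> sets ?\<nu>" by simp
      qed
      show "incseq A" unfolding A_def incseq_def by (intro allI impI Union_mono image_mono) simp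
    qed
    moreover have "(SUP n. emeasure ?\<nu> (A n)) \<le> ennreal e"
      unfolding A_def using sub by (intro SUP_least fin) auto
    ultimately show ?thesis using Uc by simp
  qed
qed

text \<open>The density is the Radon-Nikodym derivative of the Stieltjes measure of
  \<open>F\<close>. That measure is absolutely continuous: a Lebesgue null set lies in an open set
  of length below \<open>d\<close>, whose part in \<open>{a<..<b}\<close> has mass at most
  \<open>e\<close>.\<close>

lemma ac_real_mono_density:
  fixes F :: "real \<Rightarrow> real"
  assumes ac: "ac_real a b F" and mono: "mono_on {a..b} F" and ab: "a \<le> b"
  obtains f where "integrable lborel f" "\<And>s t. a \<le> s \<Longrightarrow> s \<le> t \<Longrightarrow> t \<le> b \<Longrightarrow> (LINT u:{s..t}|lborel. f u) = F t - F s"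
proof -
  \<comment> \<open>Constant extension beyond \<open>{a..b}\<close> gives a function that is
    monotone and continuous on the whole line, as the Stieltjes measure requires.\<close>
  define G where "G = (\<lambda>t. F (max a (min b t)))"
  have G: "G t = F t" if "t \<in> {a..b}" for t using that by (simp add: G_def)
  have Gmono: "G s \<le> G t" if "s \<le> t" for s t
    unfolding G_def using that ab by (intro mono_onD[OF mono]) auto
  have Gcont: "continuous_on UNIV G"
    unfolding G_def using ab
    by (intro continuous_on_compose2[OF ac_real_continuous_on[OF ac]] continuous_intros) auto
  define \<nu> where "\<nu> = interval_measure G"
  have [measurable_cong, simp]: "sets \<nu> = sets borel" by (simp add: \<nu>_def)
  have Icc: "emeasure \<nu> {s..t} = ennreal (G t - G s)" if "s \<le> t" for s t
    unfolding \<nu>_def using that Gmono Gcont by (intro emeasure_interval_measure_Icc) auto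
  define \<nu>' where "\<nu>' = density \<nu> (indicator {a..b})"
  have [measurable_cong, simp]: "sets \<nu>' = sets borel" by (simp add: \<nu>'_def)
  have \<nu>': "emeasure \<nu>' A = emeasure \<nu> (A \<inter> {a..b})" if "A \<in> sets borel" for A
    using that by (simp add: \<nu>'_def emeasure_density indicator_inter_arith[symmetric] Int_commute mult.commute)
  have "absolutely_continuous lborel \<nu>'"
    unfolding absolutely_continuous_def
  proof
    fix N :: "real set" assume N: "N \<in> null_sets lborel"
    then have [measurable]: "N \<in> sets borel" by auto
    have "emeasure \<nu>' N \<le> 0"
    proof (rule ennreal_le_epsilon)
      fix e :: real assume "0 < e"
      then obtain d where d: "d > 0" "\<And>I. nonoverlapping a b I \<Longrightarrow> increments id I < d \<Longrightarrow> increments F I < e"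
        using ac unfolding ac_real_def by metis
      obtain V where V: "open V" "N \<subseteq> V" "emeasure lborel (V - N) < d"
        using outer_regular_lborel[OF \<open>N \<in> sets borel\<close> d(1)] by blast
      have "emeasure lborel (V \<inter> {a<..<b}) \<le> emeasure lborel V" using V(1) by (intro emeasure_mono) auto
      also have "\<dots> = emeasure lborel (V - N)" using N V by (simp add: emeasure_Diff_null_set)
      also note V(3)
      finally have lt: "emeasure lborel (V \<inter> {a<..<b}) < ennreal d" .
      have "emeasure (interval_measure G) (V \<inter> {a<..<b}) \<le> ennreal e"
      proof (rule emeasure_interval_measure_open_le[OF Gmono Gcont _ _ _ lt])
        fix I assume I: "nonoverlapping a b I" "increments id I < d"
        have "increments G I = increments F I"
          unfolding increments_def using I(1) by (intro sum.cong) (auto simp: nonoverlapping_def G)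
        then show "increments G I \<le> e" using d(2)[OF I] by simp
      qed (use V(1) in auto)
      then have e: "emeasure \<nu> (V \<inter> {a<..<b}) \<le> ennreal e" by (simp add: \<nu>_def)
      \<comment> \<open>Points carry no mass, so the endpoints left out of \<open>{a<..<b}\<close>
        do not count.\<close>
      have pt: "emeasure \<nu> {t} = 0" for t using Icc[of t t] by simp
      have "emeasure \<nu>' N \<le> emeasure \<nu> ((V \<inter> {a<..<b}) \<union> {a, b})"
        using V(1,2) by (subst \<nu>') (auto intro!: emeasure_mono)
      also have "\<dots> \<le> emeasure \<nu> (V \<inter> {a<..<b}) + emeasure \<nu> {a, b}"
        using V(1) by (intro emeasure_subadditive) auto
      also have "emeasure \<nu> {a, b} \<le> emeasure \<nu> {a} + emeasure \<nu> {b}"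
        using emeasure_subadditive[of "{a}" \<nu> "{b}"] by (simp add: insert_commute)
      finally show "emeasure \<nu>' N \<le> 0 + ennreal e" using e pt by (auto intro: order_trans)
    qed
    then show "N \<in> null_sets \<nu>'" by (simp add: null_sets_def)
  qed
  then obtain h where h[measurable]: "h \<in> borel_measurable lborel" and dens: "density lborel h = \<nu>'"
    using sigma_finite_measure.Radon_Nikodym[OF sigma_finite_lborel, of \<nu>'] by auto
  have hI: "(\<integral>\<^sup>+u. h u * indicator A u \<partial>lborel) = emeasure \<nu> (A \<inter> {a..b})" if "A \<in> sets borel" for A
    using \<nu>'[OF that] that unfolding dens[symmetric] by (simp add: emeasure_density)
  have tot: "(\<integral>\<^sup>+u. h u \<partial>lborel) = ennreal (G b - G a)"
    using hI[of UNIV] Icc[OF ab] by simp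
  then have "AE u in lborel. h u \<noteq> \<infinity>" by (intro nn_integral_PInf_AE) auto
  then have ae: "AE u in lborel. ennreal (enn2real (h u)) = h u"
    by eventually_elim (simp add: less_top)
  \<comment> \<open>The total mass is finite, so \<open>h\<close> is finite almost everywhere and
    may be replaced by a real function.\<close>
  define f where "f = (\<lambda>u. enn2real (h u))"
  have [measurable]: "f \<in> borel_measurable borel" unfolding f_def by measurable
  have int: "integrable lborel f"
  proof (rule integrableI_nonneg)
    have "(\<integral>\<^sup>+u. ennreal (f u) \<partial>lborel) = (\<integral>\<^sup>+u. h u \<partial>lborel)"
      unfolding f_def using ae by (intro nn_integral_cong_AE)
    then show "(\<integral>\<^sup>+u. ennreal (f u) \<partial>lborel) < \<infinity>" using tot by simp
  qed (auto simp: f_def)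
  moreover have "(LINT u:{s..t}|lborel. f u) = F t - F s" if st: "a \<le> s" "s \<le> t" "t \<le> b" for s t
  proof -
    have "ennreal (LINT u:{s..t}|lborel. f u) = (\<integral>\<^sup>+u. ennreal (indicator {s..t} u *\<^sub>R f u) \<partial>lborel)"
      unfolding set_lebesgue_integral_def
      by (intro nn_integral_eq_integral[symmetric] integrable_mult_indicator int) (auto simp: f_def)
    also have "\<dots> = (\<integral>\<^sup>+u. h u * indicator {s..t} u \<partial>lborel)"
    proof (rule nn_integral_cong_AE)
      show "AE u in lborel. ennreal (indicator {s..t} u *\<^sub>R f u) = h u * indicator {s..t} u"
        using ae by eventually_elim (auto simp: f_def split: split_indicator)
    qed
    also have "\<dots> = emeasure \<nu> ({s..t} \<inter> {a..b})" by (rule hI) simp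
    also have "{s..t} \<inter> {a..b} = {s..t}" using st by auto
    also have "emeasure \<nu> {s..t} = ennreal (F t - F s)" using Icc[OF st(2)] st by (simp add: G)
    finally have "ennreal (LINT u:{s..t}|lborel. f u) = ennreal (F t - F s)" .
    moreover have "0 \<le> (LINT u:{s..t}|lborel. f u)"
      unfolding set_lebesgue_integral_def by (intro integral_nonneg_AE) (auto simp: f_def)
    moreover have "0 \<le> F t - F s" using mono_onD[OF mono, of s t] st by auto
    ultimately show ?thesis by simp
  qed
  ultimately show ?thesis using that by blast
qed

lemma ac_real_FTC:
  assumes "ac_real a b F" "a \<le> b"
  obtains f :: "real \<Rightarrow> real" where "integrable lborel f" "\<And>s t. a \<le> s \<Longrightarrow> s \<le> t \<Longrightarrow> t \<le> b \<Longrightarrow> (LINT u:{s..t}|lborel. f u) = F t - F s"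
    "AE t in lborel. t \<in> {a<..<b} \<longrightarrow> (F has_real_derivative f t) (at t)"
proof -
  obtain G H where GH: "ac_real a b G" "mono_on {a..b} G" "ac_real a b H" "mono_on {a..b} H" "\<And>t. F t = G t - H t"
    using ac_real_jordan[OF assms(1)] by blast
  obtain g where g: "integrable lborel g" "\<And>s t. a \<le> s \<Longrightarrow> s \<le> t \<Longrightarrow> t \<le> b \<Longrightarrow> (LINT u:{s..t}|lborel. g u) = G t - G s"
    using ac_real_mono_density[OF GH(1,2) assms(2)] by blast
  obtain h where h: "integrable lborel h" "\<And>s t. a \<le> s \<Longrightarrow> s \<le> t \<Longrightarrow> t \<le> b \<Longrightarrow> (LINT u:{s..t}|lborel. h u) = H t - H s"
    using ac_real_mono_density[OF GH(3,4) assms(2)] by blast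
  have int: "integrable lborel (\<lambda>u. g u - h u)" using g(1) h(1) by simp
  have eq: "(LINT u:{s..t}|lborel. g u - h u) = F t - F s" if "a \<le> s" "s \<le> t" "t \<le> b" for s t
  proof -
    have "set_integrable lborel {s..t} g" "set_integrable lborel {s..t} h"
      unfolding set_integrable_def using g(1) h(1) by (intro integrable_mult_indicator; simp)+
    then show ?thesis using g(2)[OF that] h(2)[OF that] GH(5) by simp
  qed
  show ?thesis using that[OF int eq AE_has_real_derivative_integral[OF int eq]] by blast
qed

text \<open>The scalar result is applied to each coordinate; the basis is finite, so the exceptional
  null sets merge into one.\<close>

theorem abs_cont_on_FTC:
  fixes x :: "real \<Rightarrow> 'a::euclidean_space"
  assumes "abs_cont_on a b x" "a \<le> b"
  obtains f where "integrable lborel f" "\<And>s t. a \<le> s \<Longrightarrow> s \<le> t \<Longrightarrow> t \<le> b \<Longrightarrow> (LINT u:{s..t}|lborel. f u) = x t - x s"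
    "AE t in lborel. t \<in> {a<..<b} \<longrightarrow> (x has_vector_derivative f t) (at t)"
proof -
  let ?P = "\<lambda>c f. integrable lborel f \<and> (\<forall>s t. a \<le> s \<longrightarrow> s \<le> t \<longrightarrow> t \<le> b \<longrightarrow> (LINT u:{s..t}|lborel. f u) = x t \<bullet> c - x s \<bullet> c) \<and>
    (AE t in lborel. t \<in> {a<..<b} \<longrightarrow> ((\<lambda>t. x t \<bullet> c) has_real_derivative f t) (at t))"
  have "\<exists>f. ?P c f" if "c \<in> Basis" for c
    by (rule ac_real_FTC[OF abs_cont_on_imp_ac_real[OF assms(1) that] assms(2)]) blast
  then have "\<exists>f. \<forall>c\<in>Basis. ?P c (f c)" by (intro bchoice) blast
  then obtain f where "\<forall>c\<in>Basis. ?P c (f c)" by (elim exE)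
  then have f: "\<And>c. c \<in> Basis \<Longrightarrow> integrable lborel (f c)"
    "\<And>c s t. c \<in> Basis \<Longrightarrow> a \<le> s \<Longrightarrow> s \<le> t \<Longrightarrow> t \<le> b \<Longrightarrow> (LINT u:{s..t}|lborel. f c u) = x t \<bullet> c - x s \<bullet> c"
    "\<And>c. c \<in> Basis \<Longrightarrow> AE t in lborel. t \<in> {a<..<b} \<longrightarrow> ((\<lambda>t. x t \<bullet> c) has_real_derivative f c t) (at t)"
    by blast+
  define h where "h = (\<lambda>t. \<Sum>c\<in>Basis. f c t *\<^sub>R c)"
  have int: "integrable lborel h"
    unfolding h_def using f(1) by (intro Bochner_Integration.integrable_sum integrable_scaleR_left) auto
  have hc: "h t \<bullet> c = f c t" if "c \<in> Basis" for c t
    using that by (simp add: h_def inner_sum_left_Basis)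
  have eq: "(LINT u:{s..t}|lborel. h u) = x t - x s" if st: "a \<le> s" "s \<le> t" "t \<le> b" for s t
  proof (rule euclidean_eqI)
    fix c :: 'a assume c: "c \<in> Basis"
    have "(LINT u:{s..t}|lborel. h u) \<bullet> c = (LINT u|lborel. (indicator {s..t} u *\<^sub>R h u) \<bullet> c)"
      unfolding set_lebesgue_integral_def using int
      by (intro integral_inner_left[symmetric] integrable_mult_indicator) auto
    also have "\<dots> = (LINT u:{s..t}|lborel. f c u)"
      unfolding set_lebesgue_integral_def using c by (simp add: hc)
    finally show "(LINT u:{s..t}|lborel. h u) \<bullet> c = (x t - x s) \<bullet> c"
      using f(2)[OF c st] by (simp add: inner_diff_left)
  qed
  have "AE t in lborel. \<forall>c\<in>Basis. t \<in> {a<..<b} \<longrightarrow> ((\<lambda>t. x t \<bullet> c) has_real_derivative f c t) (at t)"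
    using f(3) by (intro AE_finite_allI) auto
  then have "AE t in lborel. t \<in> {a<..<b} \<longrightarrow> (x has_vector_derivative h t) (at t)"
  proof eventually_elim
    case (elim t)
    show ?case
    proof
      assume t: "t \<in> {a<..<b}"
      have "((\<lambda>t. \<Sum>c\<in>Basis. (x t \<bullet> c) *\<^sub>R c) has_vector_derivative (\<Sum>c\<in>Basis. (x t \<bullet> c) *\<^sub>R 0 + f c t *\<^sub>R c)) (at t)"
        using elim t by (intro has_vector_derivative_sum has_vector_derivative_scaleR) auto
      then show "(x has_vector_derivative h t) (at t)" by (simp add: h_def euclidean_representation)
    qed
  qed
  from that[OF int eq this] show ?thesis by blast
qed

section \<open>Integrals and convex analysis\<close>

text \<open>Measurability of \<open>f\<close> is deliberately not assumed: the lemma is applied to the running cost, whose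
  measurability is never established.\<close>

lemma nn_integral_disjoint_union:
  fixes f :: "'a \<Rightarrow> ennreal"
  assumes [measurable]: "A \<in> sets M" "B \<in> sets M" and disj: "A \<inter> B = {}"
  shows "(\<integral>\<^sup>+u\<in>A \<union> B. f u \<partial>M) = (\<integral>\<^sup>+u\<in>A. f u \<partial>M) + (\<integral>\<^sup>+u\<in>B. f u \<partial>M)"
proof (rule antisym)
  \<comment> \<open>The integral is a supremum over simple minorants, which are measurable even if
    \<open>f\<close> is not; each one splits along \<open>A\<close> and \<open>B\<close>.\<close>
  show "(\<integral>\<^sup>+u\<in>A \<union> B. f u \<partial>M) \<le> (\<integral>\<^sup>+u\<in>A. f u \<partial>M) + (\<integral>\<^sup>+u\<in>B. f u \<partial>M)"
    unfolding nn_integral_def[of M "\<lambda>u. f u * indicator (A \<union> B) u"]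
  proof (rule SUP_least)
    fix g assume "g \<in> {g. simple_function M g \<and> g \<le> (\<lambda>u. f u * indicator (A \<union> B) u)}"
    then have g: "simple_function M g" "\<And>u. g u \<le> f u * indicator (A \<union> B) u" by (auto simp: le_fun_def)
    have [measurable]: "g \<in> borel_measurable M" using g(1) by (rule borel_measurable_simple_function)
    have "g u = g u * indicator A u + g u * indicator B u" for u
      using g(2)[of u] disj by (auto split: split_indicator)
    then have "integral\<^sup>S M g = (\<integral>\<^sup>+u. g u * indicator A u + g u * indicator B u \<partial>M)"
      using nn_integral_eq_simple_integral[OF g(1)] by simp
    also have "\<dots> = (\<integral>\<^sup>+u. g u * indicator A u \<partial>M) + (\<integral>\<^sup>+u. g u * indicator B u \<partial>M)"
      by (rule nn_integral_add) measurable
    also have "\<dots> \<le> (\<integral>\<^sup>+u\<in>A. f u \<partial>M) + (\<integral>\<^sup>+u\<in>B. f u \<partial>M)"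
    proof (intro add_mono nn_integral_mono)
      show "g u * indicator A u \<le> f u * indicator A u" "g u * indicator B u \<le> f u * indicator B u" for u
        using g(2)[of u] by (auto split: split_indicator)
    qed
    finally show "integral\<^sup>S M g \<le> (\<integral>\<^sup>+u\<in>A. f u \<partial>M) + (\<integral>\<^sup>+u\<in>B. f u \<partial>M)" .
  qed
  \<comment> \<open>Conversely, a minorant on \<open>A\<close> and one on \<open>B\<close> add up to
    one on the union by disjointness; the two suprema are then taken in turn.\<close>
  define S where "S = (\<lambda>h::'a \<Rightarrow> ennreal. {g. simple_function M g \<and> g \<le> h})"
  have ne: "S h \<noteq> {}" for h
    unfolding S_def by (auto intro!: exI[of _ "\<lambda>_. 0"] simp: le_fun_def)
  let ?a = "\<lambda>u. f u * indicator A u" and ?b = "\<lambda>u. f u * indicator B u" and ?c = "\<lambda>u. f u * indicator (A \<union> B) u"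
  have "integral\<^sup>S M g + integral\<^sup>S M h \<le> integral\<^sup>N M ?c" if "g \<in> S ?a" "h \<in> S ?b" for g h
  proof -
    have gh: "simple_function M g" "simple_function M h" "\<And>u. g u \<le> ?a u" "\<And>u. h u \<le> ?b u"
      using that by (auto simp: S_def le_fun_def)
    have "integral\<^sup>S M g + integral\<^sup>S M h = (\<integral>\<^sup>+u. g u + h u \<partial>M)"
      using gh(1,2) by (simp add: nn_integral_add borel_measurable_simple_function nn_integral_eq_simple_integral[symmetric])
    also have "\<dots> \<le> integral\<^sup>N M ?c"
    proof (rule nn_integral_mono)
      show "g u + h u \<le> ?c u" for u
        using gh(3,4)[of u] disj by (auto split: split_indicator_asm split_indicator)
    qed
    finally show ?thesis .
  qed
  then have "integral\<^sup>S M g + (SUP h\<in>S ?b. integral\<^sup>S M h) \<le> integral\<^sup>N M ?c" if "g \<in> S ?a" for g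
    using that ne by (subst ennreal_SUP_add_right) (auto intro!: SUP_least)
  then have "(SUP g\<in>S ?a. integral\<^sup>S M g) + (SUP h\<in>S ?b. integral\<^sup>S M h) \<le> integral\<^sup>N M ?c"
    using ne by (subst ennreal_SUP_add_left[symmetric]) (auto intro!: SUP_least)
  then show "(\<integral>\<^sup>+u\<in>A. f u \<partial>M) + (\<integral>\<^sup>+u\<in>B. f u \<partial>M) \<le> (\<integral>\<^sup>+u\<in>A \<union> B. f u \<partial>M)"
    unfolding nn_integral_def[of M ?a] nn_integral_def[of M ?b] S_def .
qed

text \<open>Removing the initial piece from a finite cost lowers it by at least the integral of any
  minorant \<open>h\<close> there. Finiteness of the whole makes the positive and negative parts
  finite on both pieces, so everything reduces to real arithmetic.\<close>

lemma ereal_integral_tail_le: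
  fixes f :: "real \<Rightarrow> ereal" and h :: "real \<Rightarrow> real"
  assumes ab: "a \<le> m" "m \<le> b" and fin: "ereal_integral a b f \<noteq> \<infinity>" "ereal_integral a b f \<noteq> -\<infinity>"
    and h: "set_integrable lborel {a..m} h" and le: "AE t in lborel. t \<in> {a<..<m} \<longrightarrow> ereal (h t) \<le> f t"
  shows "ereal_integral m b f \<le> ereal_integral a b f - ereal (LINT u:{a..m}|lborel. h u)"
proof -
  define P Q where "P = (\<lambda>S. \<integral>\<^sup>+t\<in>S. e2ennreal (f t) \<partial>lborel)" and "Q = (\<lambda>S. \<integral>\<^sup>+t\<in>S. e2ennreal (- f t) \<partial>lborel)"
  have un: "{a..b} = {a..<m} \<union> {m..b}" using ab by auto
  have PQ: "P {a..b} = P {a..<m} + P {m..b}" "Q {a..b} = Q {a..<m} + Q {m..b}"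
    unfolding P_def Q_def un by (intro nn_integral_disjoint_union; auto)+
  have I: "ereal_integral s b f = (if P {s..b} = \<infinity> then \<infinity> else enn2ereal (P {s..b}) - enn2ereal (Q {s..b}))" for s
    by (simp add: ereal_integral_def Let_def P_def Q_def)
  have Pf: "P {a..b} \<noteq> \<infinity>" using fin(1) I[of a] by auto
  have Qf: "Q {a..b} \<noteq> \<infinity>"
  proof
    assume "Q {a..b} = \<infinity>"
    then have "ereal_integral a b f = -\<infinity>" using Pf I[of a] by (cases "P {a..b}") auto
    then show False using fin(2) by simp
  qed
  \<comment> \<open>\<open>ennreal\<close> truncates at 0, so \<open>p\<close> and \<open>q\<close>
    are the integrals of the positive and the negative part of \<open>h\<close>.\<close>
  define p where "p = (\<integral>\<^sup>+u. ennreal (indicator {a..m} u *\<^sub>R h u) \<partial>lborel)"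
  define q where "q = (\<integral>\<^sup>+u. ennreal (- (indicator {a..m} u *\<^sub>R h u)) \<partial>lborel)"
  have le': "AE t in lborel. t \<noteq> a \<and> t \<noteq> m \<and> (t \<in> {a<..<m} \<longrightarrow> ereal (h t) \<le> f t)"
    using le AE_lborel_singleton[of a] AE_lborel_singleton[of m] by eventually_elim auto
  have "p \<le> P {a..<m}"
    unfolding p_def P_def
  proof (rule nn_integral_mono_AE, use le' in eventually_elim)
    fix t assume t: "t \<noteq> a \<and> t \<noteq> m \<and> (t \<in> {a<..<m} \<longrightarrow> ereal (h t) \<le> f t)"
    show "ennreal (indicator {a..m} t *\<^sub>R h t) \<le> e2ennreal (f t) * indicator {a..<m} t"
      using t e2ennreal_mono[of "ereal (h t)" "f t"] by (auto split: split_indicator simp: e2ennreal_ereal)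
  qed
  moreover have "Q {a..<m} \<le> q"
    unfolding q_def Q_def
  proof (rule nn_integral_mono_AE, use le' in eventually_elim)
    fix t assume t: "t \<noteq> a \<and> t \<noteq> m \<and> (t \<in> {a<..<m} \<longrightarrow> ereal (h t) \<le> f t)"
    show "e2ennreal (- f t) * indicator {a..<m} t \<le> ennreal (- (indicator {a..m} t *\<^sub>R h t))"
      using t e2ennreal_mono[of "- f t" "ereal (- h t)"] ereal_minus_le_minus[of "f t" "ereal (h t)"]
      by (auto split: split_indicator simp: e2ennreal_ereal)
  qed
  moreover have "p \<noteq> \<infinity>" "q \<noteq> \<infinity>" "(LINT u:{a..m}|lborel. h u) = enn2real p - enn2real q"
    using h unfolding p_def q_def set_integrable_def set_lebesgue_integral_def
    by (auto simp: real_lebesgue_integral_def real_integrable_def)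
  moreover obtain p1 p2 where "P {a..<m} = ennreal p1" "P {m..b} = ennreal p2" "0 \<le> p1" "0 \<le> p2"
    using Pf PQ(1) by (cases "P {a..<m}"; cases "P {m..b}") auto
  moreover obtain q1 q2 where "Q {a..<m} = ennreal q1" "Q {m..b} = ennreal q2" "0 \<le> q1" "0 \<le> q2"
    using Qf PQ(2) by (cases "Q {a..<m}"; cases "Q {m..b}") auto
  moreover have "P {a..b} = ennreal (p1 + p2)" "Q {a..b} = ennreal (q1 + q2)" using PQ calculation by simp_all
  ultimately show ?thesis
    unfolding I by (cases p; cases q) (auto simp: plus_ennreal.rep_eq enn2ereal_ennreal)
qed

text \<open>An infinite value on a set of positive measure makes the positive part infinite, and
  \<open>ereal_integral\<close> is then \<infinity> by definition, whatever the negative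
  part.\<close>

lemma ereal_integral_finite_imp_null:
  assumes "ereal_integral a b f \<noteq> \<infinity>" and E[measurable]: "E \<in> sets borel" "E \<subseteq> {a..b}"
    and inf: "AE t in lborel. t \<in> E \<longrightarrow> f t = \<infinity>"
  shows "AE t in lborel. t \<notin> E"
proof -
  have "(\<integral>\<^sup>+t. \<infinity> * indicator E t \<partial>lborel) \<le> (\<integral>\<^sup>+t\<in>{a..b}. e2ennreal (f t) \<partial>lborel)"
    using inf by (intro nn_integral_mono_AE, eventually_elim) (use E(2) in \<open>auto split: split_indicator simp: e2ennreal_infty\<close>)
  moreover have "(\<integral>\<^sup>+t\<in>{a..b}. e2ennreal (f t) \<partial>lborel) \<noteq> \<infinity>"
    using assms(1) by (auto simp: ereal_integral_def Let_def)
  ultimately have "\<infinity> * emeasure lborel E < \<infinity>"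
    by (auto simp: nn_integral_cmult_indicator less_top[symmetric] top_unique)
  then have "emeasure lborel E = 0" by (auto simp: ennreal_mult_eq_top_iff less_top[symmetric])
  then have "E \<in> null_sets lborel" by auto
  then show ?thesis by (rule AE_not_in)
qed

text \<open>The point \<open>(v0, r)\<close> lies strictly below the closed convex epigraph. A
  separating hyperplane that is not vertical, solved for its last coordinate, is the graph of the
  required affine function.\<close>

lemma affine_minorant:
  fixes \<phi> :: "'a::euclidean_space \<Rightarrow> ereal"
  assumes conv: "\<And>u w a. 0 \<le> a \<Longrightarrow> a \<le> 1 \<Longrightarrow> \<phi> (a *\<^sub>R u + (1 - a) *\<^sub>R w) \<le> ereal a * \<phi> u + ereal (1 - a) * \<phi> w"
    and proper: "\<And>v. \<phi> v \<noteq> -\<infinity>" "\<phi> v1 \<noteq> \<infinity>"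
    and cl: "closed {z. \<phi> (fst z) \<le> ereal (snd z)}"
    and r: "ereal r < \<phi> v0"
  obtains p \<beta> where "\<And>v. ereal (\<beta> + p \<bullet> v) < \<phi> v" "r < \<beta> + p \<bullet> v0"
proof -
  define E where "E = {z. \<phi> (fst z) \<le> ereal (snd z)}"
  have "convex E"
    unfolding convex_def
  proof (intro ballI allI impI)
    fix y z :: "'a \<times> real" and a c :: real
    assume yz: "y \<in> E" "z \<in> E" and ac: "0 \<le> a" "0 \<le> c" "a + c = 1"
    have "\<phi> (a *\<^sub>R fst y + (1 - a) *\<^sub>R fst z) \<le> ereal a * \<phi> (fst y) + ereal (1 - a) * \<phi> (fst z)"
      using ac by (intro conv) auto
    also have "\<dots> \<le> ereal a * ereal (snd y) + ereal (1 - a) * ereal (snd z)"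
      using yz ac by (intro add_mono ereal_mult_left_mono) (auto simp: E_def)
    moreover have "c = 1 - a" using ac by simp
    ultimately show "a *\<^sub>R y + c *\<^sub>R z \<in> E" by (simp add: E_def)
  qed
  obtain s1 where s1: "\<phi> v1 = ereal s1" using proper(1)[of v1] proper(2) by (cases "\<phi> v1") auto
  have sep: "\<exists>p q \<beta>. p \<bullet> w + q * c < \<beta> \<and> 0 \<le> q \<and> (\<forall>v s. \<phi> v \<le> ereal s \<longrightarrow> \<beta> < p \<bullet> v + q * s)"
    if w: "ereal c < \<phi> w" for w c
  proof -
    have "(w, c) \<notin> E" using w by (auto simp: E_def)
    then obtain h \<beta> where h: "h \<bullet> (w, c) < \<beta>" "\<And>z. z \<in> E \<Longrightarrow> h \<bullet> z > \<beta>"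
      using separating_hyperplane_closed_point[OF \<open>convex E\<close>, of "(w, c)"] cl unfolding E_def by blast
    obtain p q where pq: "h = (p, q)" by (cases h)
    have *: "\<beta> < p \<bullet> v + q * s" if "\<phi> v \<le> ereal s" for v s
      using h(2)[of "(v, s)"] that by (simp add: E_def pq)
    have "0 \<le> q"
    proof (rule ccontr)
      assume "\<not> 0 \<le> q"
      \<comment> \<open>With \<open>q < 0\<close>, the functional drops to \<open>\<beta>\<close> or
        below high enough over \<open>v1\<close>, although the epigraph contains every point from
        \<open>s1\<close> upwards.\<close>
      then have "p \<bullet> v1 + q * max s1 ((\<beta> - p \<bullet> v1) / q) \<le> \<beta>"
        using mult_left_mono_neg[of "(\<beta> - p \<bullet> v1) / q" "max s1 ((\<beta> - p \<bullet> v1) / q)" q] by simp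
      then show False using *[of v1 "max s1 ((\<beta> - p \<bullet> v1) / q)"] s1 by simp
    qed
    then show ?thesis using h(1) * pq by (intro exI[of _ p] exI[of _ q] exI[of _ \<beta>]) auto
  qed
  have graph: "\<exists>p \<beta>. (\<forall>v. ereal (\<beta> + p \<bullet> v) < \<phi> v) \<and> c < \<beta> + p \<bullet> w"
    if "p \<bullet> w + q * c < \<beta>" "0 < q" "\<And>v s. \<phi> v \<le> ereal s \<Longrightarrow> \<beta> < p \<bullet> v + q * s" for w c p q \<beta>
  proof (intro exI conjI allI)
    have aff: "\<beta> / q + (- (1/q) *\<^sub>R p) \<bullet> v = (\<beta> - p \<bullet> v) / q" for v by (simp add: diff_divide_distrib)
    show "c < \<beta> / q + (- (1/q) *\<^sub>R p) \<bullet> w" unfolding aff using that(1,2) by (simp add: field_simps)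
    show "ereal (\<beta> / q + (- (1/q) *\<^sub>R p) \<bullet> v) < \<phi> v" for v
    proof (cases "\<phi> v")
      case (real s)
      then show ?thesis unfolding aff using that(3)[of v s] that(2) by (simp add: field_simps)
    qed (use proper(1)[of v] in auto)
  qed
  \<comment> \<open>If \<open>\<phi> w\<close> is finite, the epigraph meets the vertical line
    through \<open>(w, c)\<close>, and a vertical hyperplane cannot separate two points of that
    line.\<close>
  have positive: "0 < q" if H: "p \<bullet> w + q * c < \<beta>" "0 \<le> q" "\<And>v s. \<phi> v \<le> ereal s \<Longrightarrow> \<beta> < p \<bullet> v + q * s" "\<phi> w \<noteq> \<infinity>" for w c p q \<beta>
  proof (rule ccontr)
    assume "\<not> 0 < q"
    moreover obtain s where "\<phi> w = ereal s" using H(4) proper(1)[of w] by (cases "\<phi> w") auto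
    ultimately show False using H(1,2) H(3)[of w s] by simp
  qed
  obtain p q \<beta> where pq: "p \<bullet> v0 + q * r < \<beta>" "0 \<le> q" "\<And>v s. \<phi> v \<le> ereal s \<Longrightarrow> \<beta> < p \<bullet> v + q * s"
    using sep[OF r] by blast
  show ?thesis
  proof (cases "q = 0")
    case False
    then show ?thesis using graph[OF pq(1) _ pq(3)] pq(2) that by auto
  next
    case True
    \<comment> \<open>The separating hyperplane is vertical: tilt a non-vertical minorant by a large multiple of it.\<close>
    have "ereal (s1 - 1) < \<phi> v1" using s1 by simp
    then obtain p' q' \<beta>' where pq': "p' \<bullet> v1 + q' * (s1 - 1) < \<beta>'" "0 \<le> q'" "\<And>v s. \<phi> v \<le> ereal s \<Longrightarrow> \<beta>' < p' \<bullet> v + q' * s"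
      using sep by blast
    obtain p1 \<beta>1 where min1: "\<And>v. ereal (\<beta>1 + p1 \<bullet> v) < \<phi> v"
      using graph[OF pq'(1) positive[OF pq' proper(2)] pq'(3)] by blast
    \<comment> \<open>Large enough for the tilted function to exceed \<open>r\<close> at
      \<open>v0\<close>; nonnegative, so that the tilt does not raise the minorant where
      \<open>\<phi>\<close> is finite.\<close>
    define k where "k = max 0 ((r - (\<beta>1 + p1 \<bullet> v0)) / (\<beta> - p \<bullet> v0) + 1)"
    have gap: "\<beta> - p \<bullet> v0 > 0" using pq(1) True by simp
    have "(r - (\<beta>1 + p1 \<bullet> v0)) / (\<beta> - p \<bullet> v0) < k" by (simp add: k_def)
    then have "r < (\<beta>1 + p1 \<bullet> v0) + k * (\<beta> - p \<bullet> v0)" using gap by (simp add: pos_divide_less_eq)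
    moreover have aff: "(\<beta>1 + k * \<beta>) + (p1 - k *\<^sub>R p) \<bullet> v = (\<beta>1 + p1 \<bullet> v) + k * (\<beta> - p \<bullet> v)" for v
      by (simp add: algebra_simps)
    ultimately have "r < (\<beta>1 + k * \<beta>) + (p1 - k *\<^sub>R p) \<bullet> v0" unfolding aff by simp
    moreover have "ereal ((\<beta>1 + k * \<beta>) + (p1 - k *\<^sub>R p) \<bullet> v) < \<phi> v" for v
    proof (cases "\<phi> v")
      case (real s)
      then have "\<beta> - p \<bullet> v < 0" using pq(3)[of v s] True by simp
      then have "k * (\<beta> - p \<bullet> v) \<le> 0" by (intro mult_nonneg_nonpos) (auto simp: k_def)
      then show ?thesis using min1[of v] real unfolding aff by simp
    qed (use proper(1)[of v] in auto)
    ultimately show ?thesis by (intro that)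
  qed
qed

lemma abs_cont_on_subinterval:
  assumes "abs_cont_on a b x" "a \<le> a'"
  shows "abs_cont_on a' b x"
  unfolding abs_cont_on_def
proof (intro allI impI)
  fix e :: real assume "e > 0"
  from assms(1)[unfolded abs_cont_on_def, THEN spec, THEN mp, OF this]
  obtain d where "d > 0" and *: "\<forall>I. finite I \<and> (\<forall>(u,w)\<in>I. a \<le> u \<and> u \<le> w \<and> w \<le> b) \<and>
        (\<forall>(u,w)\<in>I. \<forall>(u',w')\<in>I. (u,w) \<noteq> (u',w') \<longrightarrow> {u<..<w} \<inter> {u'<..<w'} = {}) \<and>
        (\<Sum>(u,w)\<in>I. w - u) < d \<longrightarrow> (\<Sum>(u,w)\<in>I. norm (x w - x u)) < e"
    by (elim exE conjE)
  show "\<exists>d>0. \<forall>I. finite I \<and> (\<forall>(u,w)\<in>I. a' \<le> u \<and> u \<le> w \<and> w \<le> b) \<and>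
        (\<forall>(u,w)\<in>I. \<forall>(u',w')\<in>I. (u,w) \<noteq> (u',w') \<longrightarrow> {u<..<w} \<inter> {u'<..<w'} = {}) \<and>
        (\<Sum>(u,w)\<in>I. w - u) < d \<longrightarrow> (\<Sum>(u,w)\<in>I. norm (x w - x u)) < e"
  proof (intro exI[of _ d] conjI allI impI, fact \<open>d > 0\<close>, elim conjE, rule *[THEN spec, THEN mp], intro conjI)
    fix I assume "\<forall>(u,w)\<in>I. a' \<le> u \<and> u \<le> w \<and> w \<le> b"
    then show "\<forall>(u,w)\<in>I. a \<le> u \<and> u \<le> w \<and> w \<le> b" using assms(2) by fastforce
  qed
qed

section \<open>Almost optimal arcs\<close>

lemma abs_cont_on_imp_continuous_on:
  fixes x :: "real \<Rightarrow> 'a::euclidean_space"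
  assumes "abs_cont_on a b x"
  shows "continuous_on {a..b} x"
  using abs_cont_on_imp_ac_real[OF assms] ac_real_continuous_on
  by (subst continuous_on_componentwise) blast

lemma norm_increment_le:
  fixes x :: "real \<Rightarrow> 'a::euclidean_space"
  assumes int: "integrable lborel f" and ftc: "(LINT u:{a..s}|lborel. f u) = x s - x a"
    and bd: "AE t in lborel. t \<in> {a<..<s} \<longrightarrow> norm (f t) \<le> C" and as: "a \<le> s"
  shows "norm (x s - x a) \<le> C * (s - a)"
proof -
  have i: "integrable lborel (\<lambda>u. indicator {a..s} u *\<^sub>R f u)" using int by (intro integrable_mult_indicator) auto
  have c: "integrable lborel (\<lambda>u. indicator {a..s} u *\<^sub>R C)"
    by (intro integrable_scaleR_left integrable_real_indicator) (auto simp: emeasure_lborel_Icc_eq)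
  have "norm (x s - x a) \<le> (LINT u|lborel. norm (indicator {a..s} u *\<^sub>R f u))"
    unfolding ftc[symmetric] set_lebesgue_integral_def by (rule integral_norm_bound)
  also have "\<dots> \<le> (LINT u|lborel. indicator {a..s} u *\<^sub>R C)"
  proof (rule integral_mono_AE[OF integrable_norm[OF i] c])
    show "AE u in lborel. norm (indicator {a..s} u *\<^sub>R f u) \<le> indicator {a..s} u *\<^sub>R C"
      using bd AE_lborel_singleton[of a] AE_lborel_singleton[of s]
      by eventually_elim (auto split: split_indicator)
  qed
  also have "\<dots> = C * (s - a)" using as by simp
  finally show ?thesis .
qed

text \<open>The velocity bound is known only while \<open>x\<close> stays within distance 1 of
  \<open>x a\<close>. At a first exit time the bound, valid up to then, would give a displacement of
  at most \<open>C * (b - a) < 1\<close>, so there is no exit.\<close>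

lemma norm_increment_le_of_local_bound:
  fixes x :: "real \<Rightarrow> 'a::euclidean_space"
  assumes int: "integrable lborel f" and ftc: "\<And>s t. a \<le> s \<Longrightarrow> s \<le> t \<Longrightarrow> t \<le> b \<Longrightarrow> (LINT u:{s..t}|lborel. f u) = x t - x s"
    and bd: "AE t in lborel. t \<in> {a<..<b} \<longrightarrow> norm (x t - x a) \<le> 1 \<longrightarrow> norm (f t) \<le> C"
    and cont: "continuous_on {a..b} x" and C: "0 \<le> C" "C * (b - a) < 1" and s: "a \<le> s" "s \<le> b"
  shows "norm (x s - x a) \<le> C * (s - a)"
proof -
  have loc: "norm (x s - x a) \<le> C * (s - a)"
    if "a \<le> s" "s \<le> b" "\<And>t. a < t \<Longrightarrow> t < s \<Longrightarrow> norm (x t - x a) \<le> 1" for s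
  proof (rule norm_increment_le[OF int ftc _ that(1)])
    show "AE t in lborel. t \<in> {a<..<s} \<longrightarrow> norm (f t) \<le> C"
      using bd by eventually_elim (use that in auto)
  qed (use that in auto)
  have "norm (x t - x a) \<le> 1" if t: "a \<le> t" "t \<le> b" for t
  proof (rule ccontr)
    assume t1: "\<not> norm (x t - x a) \<le> 1"
    define S where "S = {t \<in> {a..b}. 1 \<le> norm (x t - x a)}"
    have "closed S"
      unfolding S_def using cont by (intro continuous_on_closed_Collect_le continuous_intros) auto
    moreover have "S \<noteq> {}" "bdd_below S" using t1 t by (auto simp: S_def intro!: bdd_belowI[of _ a])
    ultimately have "Inf S \<in> S" by (simp add: closed_contains_Inf)
    moreover have "norm (x u - x a) \<le> 1" if "a < u" "u < Inf S" for u
    proof -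
      have "u \<notin> S" using that \<open>bdd_below S\<close> cInf_lower not_less by blast
      moreover have "u \<le> b" using that \<open>Inf S \<in> S\<close> by (auto simp: S_def)
      ultimately show ?thesis using that by (auto simp: S_def)
    qed
    ultimately have "1 \<le> C * (Inf S - a)" using loc[of "Inf S"] by (force simp: S_def)
    also have "\<dots> \<le> C * (b - a)" using \<open>Inf S \<in> S\<close> C by (intro mult_left_mono) (auto simp: S_def)
    finally show False using C by simp
  qed
  then show ?thesis using loc[of s] s by auto
qed

text \<open>At points where an arc is not differentiable, \<open>vector_derivative\<close> is a junk value, so the running cost
  controls the arc only because absolutely continuous arcs are differentiable almost everywhere.\<close>

lemma near_optimal_step:
  fixes L :: "real \<Rightarrow> 'a::euclidean_space \<Rightarrow> 'a \<Rightarrow> ereal" and x0 :: 'a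
  assumes C: "0 \<le> C" "\<And>t x v. t \<in> {0..T} \<Longrightarrow> norm x \<le> norm x0 + 1 \<Longrightarrow> norm v > C \<Longrightarrow> L t x v = \<infinity>"
    and g: "\<And>x. g x \<noteq> -\<infinity>"
    and V: "value_fun L g T (t0, x0) = ereal V0"
    and t0: "0 \<le> t0" and tau: "0 < \<tau>" "t0 + \<tau> < T" "C * \<tau> < 1"
  obtains v where "norm v \<le> C"
    "\<And>\<beta> p \<delta>. \<lbrakk>\<tau> < \<delta>; C * \<tau> < \<delta>;
        \<And>t x v. \<lbrakk>t \<in> {0..T}; dist t t0 < \<delta>; dist x x0 < \<delta>\<rbrakk> \<Longrightarrow> ereal (\<beta> + p \<bullet> v) \<le> L t x v\<rbrakk>
      \<Longrightarrow> value_fun L g T (t0 + \<tau>, x0 + \<tau> *\<^sub>R v) \<le> ereal (V0 + \<tau>\<^sup>2 - \<tau> * (\<beta> + p \<bullet> v))"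
proof -
  define F where "F = (\<lambda>x t. L t (x t) (vector_derivative x (at t)))"
  have V_eq: "value_fun L g T (s, y) = (INF x \<in> {x. abs_cont_on s T x \<and> x s = y}. g (x T) + ereal_integral s T (F x))"
    if "0 \<le> s" "s < T" for s y
    using that by (simp add: value_fun_def Let_def F_def)
  \<comment> \<open>The tolerance is quadratic in \<open>\<tau>\<close>, so it vanishes in the limit
    after division by \<open>\<tau>\<close>.\<close>
  have "value_fun L g T (t0, x0) < ereal (V0 + \<tau>\<^sup>2)" using V tau(1) by simp
  then obtain x where x: "abs_cont_on t0 T x" "x t0 = x0" and lt: "g (x T) + ereal_integral t0 T (F x) < ereal (V0 + \<tau>\<^sup>2)"
    using t0 tau by (subst (asm) V_eq) (auto simp: INF_less_iff)
  have ge: "ereal V0 \<le> g (x T) + ereal_integral t0 T (F x)"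
    unfolding V[symmetric] using x t0 tau by (subst V_eq) (auto intro!: INF_lower)
  \<comment> \<open>In \<open>ereal\<close>, \<infinity> absorbs every summand, so \<open>lt\<close>
    makes the terminal cost finite; the bounds on both sides then make the running cost
    finite.\<close>
  obtain G where G: "g (x T) = ereal G" using g[of "x T"] lt by (cases "g (x T)") auto
  obtain I where I: "ereal_integral t0 T (F x) = ereal I"
    using lt ge G by (cases "ereal_integral t0 T (F x)") auto
  obtain f where f: "integrable lborel f" "\<And>s t. t0 \<le> s \<Longrightarrow> s \<le> t \<Longrightarrow> t \<le> T \<Longrightarrow> (LINT u:{s..t}|lborel. f u) = x t - x s"
    "AE t in lborel. t \<in> {t0<..<T} \<longrightarrow> (x has_vector_derivative f t) (at t)"
    using abs_cont_on_FTC[OF x(1)] tau by auto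
  have [measurable]: "f \<in> borel_measurable borel" using f(1) by auto
  have cont: "continuous_on {t0..T} x" by (rule abs_cont_on_imp_continuous_on[OF x(1)])
  have Feq: "AE t in lborel. t \<in> {t0<..<T} \<longrightarrow> F x t = L t (x t) (f t)"
    using f(3) by eventually_elim (auto simp: F_def vector_derivative_at)
  \<comment> \<open>\<open>E\<close> collects the times where the velocity exceeds \<open>C\<close>
    although the arc is still near \<open>x0\<close> in norm. The cost is \<infinity> almost
    everywhere on \<open>E\<close>, so \<open>E\<close> is null. The indicator makes the arc Borel
    on the whole line.\<close>
  define E where "E = {t \<in> {t0<..<T}. norm (indicator {t0<..<T} t *\<^sub>R x t) \<le> norm x0 + 1 \<and> C < norm (f t)}"
  have [measurable]: "(\<lambda>t. indicator {t0<..<T} t *\<^sub>R x t) \<in> borel_measurable borel"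
    by (intro borel_measurable_continuous_on_indicator continuous_on_subset[OF cont]) auto
  have "E \<in> sets borel" unfolding E_def by measurable
  then have "AE t in lborel. t \<notin> E"
  proof (rule ereal_integral_finite_imp_null[rotated])
    show "AE t in lborel. t \<in> E \<longrightarrow> F x t = \<infinity>"
      using Feq by eventually_elim (use C(2) t0 in \<open>auto simp: E_def\<close>)
    show "ereal_integral t0 T (F x) \<noteq> \<infinity>" using I by simp
  qed (auto simp: E_def)
  then have bd: "AE t in lborel. t \<in> {t0<..<t0 + \<tau>} \<longrightarrow> norm (x t - x t0) \<le> 1 \<longrightarrow> norm (f t) \<le> C"
  proof eventually_elim
    case (elim t)
    show ?case
    proof (intro impI)
      assume t: "t \<in> {t0<..<t0 + \<tau>}" "norm (x t - x t0) \<le> 1"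
      then have "norm (x t) \<le> norm x0 + 1" using norm_triangle_sub[of "x t" x0] x(2) by simp
      then show "norm (f t) \<le> C" using elim t tau by (auto simp: E_def)
    qed
  qed
  have near: "norm (x s - x0) \<le> C * (s - t0)" if "t0 \<le> s" "s \<le> t0 + \<tau>" for s
    unfolding x(2)[symmetric]
  proof (rule norm_increment_le_of_local_bound[OF f(1) f(2) bd _ C(1) _ that])
    show "continuous_on {t0..t0 + \<tau>} x" using tau by (intro continuous_on_subset[OF cont]) auto
  qed (use tau in auto)
  define v where "v = (x (t0 + \<tau>) - x0) /\<^sub>R \<tau>"
  have v: "x0 + \<tau> *\<^sub>R v = x (t0 + \<tau>)" using tau by (simp add: v_def)
  show ?thesis
  proof (rule that[of v])
    have "norm v = norm (x (t0 + \<tau>) - x0) / \<tau>" using tau(1) by (simp add: v_def divide_inverse_commute)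
    then show "norm v \<le> C" using near[of "t0 + \<tau>"] tau by (simp add: pos_divide_le_eq)
    fix \<beta> p \<delta> assume \<delta>: "\<tau> < \<delta>" "C * \<tau> < \<delta>"
      and min: "\<And>t x v. t \<in> {0..T} \<Longrightarrow> dist t t0 < \<delta> \<Longrightarrow> dist x x0 < \<delta> \<Longrightarrow> ereal (\<beta> + p \<bullet> v) \<le> L t x v"
    have ip: "set_integrable lborel {t0..t0 + \<tau>} (\<lambda>t. p \<bullet> f t)"
      unfolding set_integrable_def using f(1) by (intro integrable_mult_indicator integrable_inner_right) auto
    have ic: "set_integrable lborel {t0..t0 + \<tau>} (\<lambda>t. \<beta>)"
      unfolding set_integrable_def
      by (intro integrable_scaleR_left integrable_real_indicator) (auto simp: emeasure_lborel_Icc_eq)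
    have "ereal_integral (t0 + \<tau>) T (F x) \<le> ereal_integral t0 T (F x) - ereal (LINT t:{t0..t0 + \<tau>}|lborel. \<beta> + p \<bullet> f t)"
    proof (rule ereal_integral_tail_le)
      show "AE t in lborel. t \<in> {t0<..<t0 + \<tau>} \<longrightarrow> ereal (\<beta> + p \<bullet> f t) \<le> F x t"
        using Feq
      proof eventually_elim
        case (elim t)
        show ?case
        proof
          assume t: "t \<in> {t0<..<t0 + \<tau>}"
          have "norm (x t - x0) \<le> C * (t - t0)" using near t by auto
          also have "\<dots> \<le> C * \<tau>" using t C(1) by (intro mult_left_mono) auto
          finally have "dist (x t) x0 < \<delta>" using \<delta>(2) by (simp add: dist_norm)
          then have "ereal (\<beta> + p \<bullet> f t) \<le> L t (x t) (f t)"
            using t t0 tau \<delta> by (intro min) (auto simp: dist_real_def)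
          then show "ereal (\<beta> + p \<bullet> f t) \<le> F x t" using elim t tau by auto
        qed
      qed
    qed (use tau I set_integral_add(1)[OF ic ip] in auto)
    \<comment> \<open>An affine function of the velocity integrates to \<open>\<tau>\<close> times
      its value at the mean velocity \<open>v\<close>.\<close>
    also have "(LINT t:{t0..t0 + \<tau>}|lborel. \<beta> + p \<bullet> f t) = \<tau> * (\<beta> + p \<bullet> v)"
    proof -
      have "(LINT t:{t0..t0 + \<tau>}|lborel. p \<bullet> f t) = p \<bullet> (LINT t:{t0..t0 + \<tau>}|lborel. f t)"
      proof -
        have "integrable lborel (\<lambda>t. indicator {t0..t0 + \<tau>} t *\<^sub>R f t)" using f(1) by (intro integrable_mult_indicator) auto
        then show ?thesis using integral_inner_right[of p lborel "\<lambda>t. indicator {t0..t0 + \<tau>} t *\<^sub>R f t"]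
          by (simp add: set_lebesgue_integral_def)
      qed
      also have "\<dots> = p \<bullet> (\<tau> *\<^sub>R v)" using f(2)[of t0 "t0 + \<tau>"] tau x(2) v by (metis add_diff_cancel_left' le_add_same_cancel1 less_imp_le order_refl)
      moreover have "(LINT t:{t0..t0 + \<tau>}|lborel. \<beta>) = \<tau> * \<beta>" using tau by (simp add: set_lebesgue_integral_def)
      ultimately show ?thesis using set_integral_add(2)[OF ic ip] by (simp add: algebra_simps)
    qed
    finally have tail: "ereal_integral (t0 + \<tau>) T (F x) \<le> ereal (I - \<tau> * (\<beta> + p \<bullet> v))" using I by simp
    \<comment> \<open>The rest of the same arc competes in the infimum for the later starting
      point.\<close>
    have "abs_cont_on (t0 + \<tau>) T x" using x(1) tau by (auto intro: abs_cont_on_subinterval)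
    then have "value_fun L g T (t0 + \<tau>, x0 + \<tau> *\<^sub>R v) \<le> g (x T) + ereal_integral (t0 + \<tau>) T (F x)"
      using t0 tau v by (subst V_eq) (auto intro!: INF_lower)
    also have "\<dots> \<le> ereal G + ereal (I - \<tau> * (\<beta> + p \<bullet> v))" unfolding G using tail by (intro add_left_mono)
    also have "\<dots> \<le> ereal (V0 + \<tau>\<^sup>2 - \<tau> * (\<beta> + p \<bullet> v))" using lt G I by simp
    finally show "value_fun L g T (t0 + \<tau>, x0 + \<tau> *\<^sub>R v) \<le> ereal (V0 + \<tau>\<^sup>2 - \<tau> * (\<beta> + p \<bullet> v))" .
  qed
qed

section \<open>Lower semicontinuity of the Lagrangian at a fixed time and state\<close>

context
  fixes L :: "real \<Rightarrow> 'a::euclidean_space \<Rightarrow> 'a \<Rightarrow> ereal" and T t0 :: real and x0 :: 'a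
  assumes lsc: "\<forall>t\<in>{0..T}. \<forall>x v. L t x v \<le>
      Liminf (at (t, x, v) within ({0..T} \<times> UNIV \<times> UNIV)) (\<lambda>(s, y, w). L s y w)"
    and t0: "t0 \<in> {0..T}"
begin

text \<open>The filter \<open>at\<close> omits the point itself, so terms of the sequence equal to
  the limit are treated separately.\<close>

lemma lsc_eventually:
  assumes c: "c < L t0 x0 v" and lim: "ts \<longlonglongrightarrow> t0" "xs \<longlonglongrightarrow> x0" "vs \<longlonglongrightarrow> v" and dom: "\<And>n. ts n \<in> {0..T}"
  shows "\<forall>\<^sub>F n in sequentially. c < L (ts n) (xs n) (vs n)"
proof -
  have "\<forall>\<^sub>F z in at (t0, x0, v) within ({0..T} \<times> UNIV \<times> UNIV). c < (\<lambda>(s, y, w). L s y w) z"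
    using lsc t0 c by (intro less_LiminfD) (auto intro: less_le_trans)
  then obtain d where d: "d > 0" "\<And>z. z \<in> {0..T} \<times> UNIV \<times> UNIV \<Longrightarrow> z \<noteq> (t0, x0, v) \<Longrightarrow> dist z (t0, x0, v) < d
      \<Longrightarrow> c < (\<lambda>(s, y, w). L s y w) z"
    unfolding eventually_at by blast
  have "(\<lambda>n. (ts n, xs n, vs n)) \<longlonglongrightarrow> (t0, x0, v)" using lim by (intro tendsto_Pair)
  then have "\<forall>\<^sub>F n in sequentially. dist (ts n, xs n, vs n) (t0, x0, v) < d" using d(1) by (rule tendstoD)
  then show ?thesis
  proof eventually_elim
    case (elim n)
    show ?case
    proof (cases "(ts n, xs n, vs n) = (t0, x0, v)")
      case True
      then show ?thesis using c by simp
    next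
      case False
      then show ?thesis using d(2)[of "(ts n, xs n, vs n)"] elim dom by simp
    qed
  qed
qed

lemma closed_epigraph: "closed {z. L t0 x0 (fst z) \<le> ereal (snd z)}"
  unfolding closed_sequential_limits
proof (intro allI impI, elim conjE)
  fix zs and z :: "'a \<times> real" assume zs: "\<forall>n. zs n \<in> {z. L t0 x0 (fst z) \<le> ereal (snd z)}" "zs \<longlonglongrightarrow> z"
  show "z \<in> {z. L t0 x0 (fst z) \<le> ereal (snd z)}"
  proof (rule ccontr)
    assume "z \<notin> {z. L t0 x0 (fst z) \<le> ereal (snd z)}"
    then have "ereal (snd z) < L t0 x0 (fst z)" by auto
    then obtain c where c: "ereal (snd z) < ereal c" "ereal c < L t0 x0 (fst z)" using ereal_dense2 by blast
    have "\<forall>\<^sub>F n in sequentially. ereal c < L t0 x0 (fst (zs n))"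
      using t0 by (intro lsc_eventually[OF c(2)] tendsto_const tendsto_fst zs(2)) auto
    moreover have "\<forall>\<^sub>F n in sequentially. snd (zs n) < c"
      using tendsto_snd[OF zs(2)] c(1) by (intro order_tendstoD(2)) auto
    ultimately have "\<forall>\<^sub>F n in sequentially. False"
    proof eventually_elim
      case (elim n)
      have "L t0 x0 (fst (zs n)) \<le> ereal (snd (zs n))" using zs(1) by auto
      also have "\<dots> < ereal c" using elim(2) by simp
      finally show ?case using elim(1) by simp
    qed
    then show False by simp
  qed
qed

text \<open>Along a sequence of violations tending to \<open>(t0, x0)\<close> the values of
  \<open>L\<close> are below \<infinity>, which confines the velocities to \<open>cball 0 C\<close>.
  At a limit velocity, lower semicontinuity contradicts the strict inequality
  \<open>min\<close>.\<close>

lemma affine_minorant_nearby: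
  assumes C: "\<And>t x v. t \<in> {0..T} \<Longrightarrow> norm x \<le> norm x0 + 1 \<Longrightarrow> norm v > C \<Longrightarrow> L t x v = \<infinity>"
    and min: "\<And>v. ereal (\<beta> + p \<bullet> v) < L t0 x0 v"
  shows "\<exists>\<delta>>0. \<forall>t\<in>{0..T}. \<forall>x v. dist t t0 < \<delta> \<longrightarrow> dist x x0 < \<delta> \<longrightarrow> ereal (\<beta> + p \<bullet> v) \<le> L t x v"
proof (rule ccontr)
  assume neg: "\<not> ?thesis"
  have "\<exists>t x v. t \<in> {0..T} \<and> dist t t0 < \<delta> \<and> dist x x0 < \<delta> \<and> L t x v < ereal (\<beta> + p \<bullet> v)" if "\<delta> > 0" for \<delta>
    using that neg by (meson not_le)
  then have "\<forall>n::nat. \<exists>t x v. t \<in> {0..T} \<and> dist t t0 < inverse (Suc n) \<and> dist x x0 < inverse (Suc n) \<and> L t x v < ereal (\<beta> + p \<bullet> v)"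
    by simp
  then obtain ts xs vs where seq: "\<And>n::nat. ts n \<in> {0..T}" "\<And>n. dist (ts n) t0 < inverse (Suc n)"
    "\<And>n. dist (xs n) x0 < inverse (Suc n)" "\<And>n. L (ts n) (xs n) (vs n) < ereal (\<beta> + p \<bullet> vs n)"
    by metis
  have lim: "ts \<longlonglongrightarrow> t0" "xs \<longlonglongrightarrow> x0"
    using seq(2,3) by (auto intro!: metric_tendsto_imp_tendsto[OF LIMSEQ_inverse_real_of_nat] always_eventually less_imp_le simp: dist_real_def)
  have "norm (vs n) \<le> C" for n
  proof (rule ccontr)
    assume "\<not> norm (vs n) \<le> C"
    moreover have "dist (xs n) x0 < 1" using seq(3)[of n] by (rule less_le_trans) (simp add: field_simps)
    then have "norm (xs n) \<le> norm x0 + 1" using norm_triangle_sub[of "xs n" x0] by (simp add: dist_norm)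
    ultimately have "L (ts n) (xs n) (vs n) = \<infinity>" using C seq(1) by auto
    then show False using seq(4)[of n] by simp
  qed
  then have "vs n \<in> cball 0 C" for n by simp
  then obtain v r where r: "strict_mono r" "(vs \<circ> r) \<longlonglongrightarrow> v"
    using compact_cball[of "0::'a" C] unfolding compact_def by metis
  obtain c where c: "ereal (\<beta> + p \<bullet> v) < ereal c" "ereal c < L t0 x0 v" using min[of v] ereal_dense2 by blast
  have "\<forall>\<^sub>F n in sequentially. ereal c < L ((ts \<circ> r) n) ((xs \<circ> r) n) ((vs \<circ> r) n)"
    using r seq(1) by (intro lsc_eventually[OF c(2) LIMSEQ_subseq_LIMSEQ[OF lim(1)] LIMSEQ_subseq_LIMSEQ[OF lim(2)]])
      (auto simp: o_def)
  moreover have "(\<lambda>n. \<beta> + p \<bullet> (vs \<circ> r) n) \<longlonglongrightarrow> \<beta> + p \<bullet> v" using r(2) by (intro tendsto_intros)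
  then have "\<forall>\<^sub>F n in sequentially. \<beta> + p \<bullet> (vs \<circ> r) n < c" using c(1) by (intro order_tendstoD(2)) auto
  ultimately have "\<forall>\<^sub>F n in sequentially. False"
  proof eventually_elim
    case (elim n)
    then have "ereal (\<beta> + p \<bullet> vs (r n)) < L (ts (r n)) (xs (r n)) (vs (r n))" by (auto intro: less_trans[of _ "ereal c"])
    then show ?case using seq(4)[of "r n"] by simp
  qed
  then show False by simp
qed

end

section \<open>Limit velocity and estimate of the subderivative\<close>

theorem theorem5p2:
  fixes L :: "real \<Rightarrow> 'a::euclidean_space \<Rightarrow> 'a \<Rightarrow> ereal"
    and g :: "'a \<Rightarrow> ereal"
    and T :: real
  assumes L1: "\<forall>t\<in>{0..T}. \<forall>x v. L t x v \<le>
                 Liminf (at (t, x, v) within ({0..T} \<times> UNIV \<times> UNIV)) (\<lambda>(s, y, w). L s y w)"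
    and L2_convex: "\<forall>t\<in>{0..T}. \<forall>x u w. \<forall>a::real. 0 \<le> a \<and> a \<le> 1 \<longrightarrow>
                 L t x (a *\<^sub>R u + (1 - a) *\<^sub>R w) \<le> ereal a * L t x u + ereal (1 - a) * L t x w"
    and L2_proper: "\<forall>t\<in>{0..T}. \<forall>x. (\<forall>v. L t x v \<noteq> - \<infinity>) \<and> (\<exists>v. L t x v \<noteq> \<infinity>)"
    and L3: "\<forall>t\<in>{0..T}. \<forall>x v. \<forall>ts xs. (\<forall>n. ts n \<in> {0..T}) \<and> ts \<longlonglongrightarrow> t \<and> xs \<longlonglongrightarrow> x \<longrightarrow>
                 (\<exists>vs. vs \<longlonglongrightarrow> v \<and> (\<lambda>n. L (ts n) (xs n) (vs n)) \<longlonglongrightarrow> L t x v)"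
    and L4: "\<forall>R\<ge>0. \<exists>C\<ge>0. \<forall>t\<in>{0..T}. \<forall>x v. norm x \<le> R \<and> norm v > C \<longrightarrow> L t x v = \<infinity>"
    and L5: "\<exists>c \<N>. (\<forall>t\<in>{0..T}. c t \<ge> 0) \<and> c integrable_on {0..T} \<and> \<N> \<in> null_sets lborel \<and>
                 (\<forall>t\<in>{0..T} - \<N>. \<forall>x v. norm v > c t * (1 + norm x) \<longrightarrow> L t x v = \<infinity>)"
    and g_proper: "(\<forall>x. g x \<noteq> - \<infinity>) \<and> (\<exists>x. g x \<noteq> \<infinity>)"
    and g_lsc: "\<forall>x. g x \<le> Liminf (at x) g"
    and dom: "value_fun L g T (t0, x0) \<noteq> \<infinity>" "value_fun L g T (t0, x0) \<noteq> - \<infinity>"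
    and t0: "0 \<le> t0" "t0 < T"
  shows "\<exists>v0. subderivative (value_fun L g T) (t0, x0) (1, v0) \<le> - L t0 x0 v0"
proof -
  let ?V = "value_fun L g T"
  have t0T: "t0 \<in> {0..T}" using t0 by simp
  obtain V0 where V0: "?V (t0, x0) = ereal V0" using dom by (cases "?V (t0, x0)") auto
  \<comment> \<open>The radius covers every state within distance 1 of \<open>x0\<close>.\<close>
  have "norm x0 + 1 \<ge> 0" by simp
  from L4[THEN spec, THEN mp, OF this]
  obtain C where C: "0 \<le> C" "\<And>t x v. t \<in> {0..T} \<Longrightarrow> norm x \<le> norm x0 + 1 \<Longrightarrow> norm v > C \<Longrightarrow> L t x v = \<infinity>"
    by blast
  \<comment> \<open>Small enough that arcs can neither reach the final time nor leave the unit ball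
    about \<open>x0\<close>; \<open>C + 1\<close> avoids division by zero.\<close>
  define \<epsilon> where "\<epsilon> = min ((T - t0) / 2) (1 / (2 * (C + 1)))"
  have \<epsilon>: "\<epsilon> > 0" "t0 + \<epsilon> < T" "C * \<epsilon> < 1"
  proof -
    show "\<epsilon> > 0" using t0 C(1) by (simp add: \<epsilon>_def)
    have "\<epsilon> \<le> (T - t0) / 2" unfolding \<epsilon>_def by (rule min.cobounded1)
    then show "t0 + \<epsilon> < T" using t0 by (simp add: field_simps)
    have "C * \<epsilon> \<le> C * (1 / (2 * (C + 1)))" using C(1) by (intro mult_left_mono) (auto simp: \<epsilon>_def)
    also have "\<dots> < 1" using C(1) by (simp add: field_simps)
    finally show "C * \<epsilon> < 1" .
  qed
  define \<tau> where "\<tau> = (\<lambda>n::nat. \<epsilon> * inverse (real (Suc n)))"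
  have \<tau>: "0 < \<tau> n" "t0 + \<tau> n < T" "C * \<tau> n < 1" for n
  proof -
    have "\<tau> n \<le> \<epsilon> * 1" unfolding \<tau>_def using \<epsilon>(1) by (intro mult_left_mono) (auto simp: field_simps)
    then show "t0 + \<tau> n < T" "C * \<tau> n < 1" using \<epsilon> mult_left_mono[of "\<tau> n" \<epsilon> C] C(1) by auto
    show "0 < \<tau> n" using \<epsilon> by (simp add: \<tau>_def)
  qed
  have \<tau>0: "\<tau> \<longlonglongrightarrow> 0"
    unfolding \<tau>_def using tendsto_mult_left[OF LIMSEQ_inverse_real_of_nat, of \<epsilon>] by simp
  let ?near = "\<lambda>\<delta> \<beta> p. \<forall>t x v. t \<in> {0..T} \<longrightarrow> dist t t0 < \<delta> \<longrightarrow> dist x x0 < \<delta> \<longrightarrow> ereal (\<beta> + p \<bullet> v) \<le> L t x v"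
  \<comment> \<open>Quantifying over all affine minorants here makes the choice of velocities, and
    hence \<open>v0\<close>, independent of the number \<open>c\<close> used later.\<close>
  let ?Q = "\<lambda>n v. norm v \<le> C \<and> (\<forall>\<beta> p \<delta>. \<tau> n < \<delta> \<longrightarrow> C * \<tau> n < \<delta> \<longrightarrow> ?near \<delta> \<beta> p \<longrightarrow>
      ?V (t0 + \<tau> n, x0 + \<tau> n *\<^sub>R v) \<le> ereal (V0 + (\<tau> n)\<^sup>2 - \<tau> n * (\<beta> + p \<bullet> v)))"
  have "\<exists>v. ?Q n v" for n
  proof -
    obtain v where v: "norm v \<le> C" "\<And>\<beta> p \<delta>. \<lbrakk>\<tau> n < \<delta>; C * \<tau> n < \<delta>;
        \<And>t x v. \<lbrakk>t \<in> {0..T}; dist t t0 < \<delta>; dist x x0 < \<delta>\<rbrakk> \<Longrightarrow> ereal (\<beta> + p \<bullet> v) \<le> L t x v\<rbrakk>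
      \<Longrightarrow> ?V (t0 + \<tau> n, x0 + \<tau> n *\<^sub>R v) \<le> ereal (V0 + (\<tau> n)\<^sup>2 - \<tau> n * (\<beta> + p \<bullet> v))"
      using near_optimal_step[OF C _ V0 t0(1) \<tau>[of n]] g_proper by blast
    have "?Q n v"
    proof (intro conjI allI impI)
      fix \<beta> p \<delta> assume "\<tau> n < \<delta>" "C * \<tau> n < \<delta>" "?near \<delta> \<beta> p"
      then show "?V (t0 + \<tau> n, x0 + \<tau> n *\<^sub>R v) \<le> ereal (V0 + (\<tau> n)\<^sup>2 - \<tau> n * (\<beta> + p \<bullet> v))"
        by (intro v(2)) auto
    qed (rule v(1))
    then show ?thesis by blast
  qed
  then have "\<exists>vs. \<forall>n. ?Q n (vs n)" by (intro choice allI)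
  then obtain vs where vs: "\<forall>n. ?Q n (vs n)" by (elim exE)
  then have "\<forall>n. vs n \<in> cball 0 C" by simp
  then obtain v0 r where r: "strict_mono r" "(vs \<circ> r) \<longlonglongrightarrow> v0"
    using compact_cball[of "0::'a" C] unfolding compact_def by blast
  have \<tau>r: "(\<tau> \<circ> r) \<longlonglongrightarrow> 0" using \<tau>0 r(1) by (rule LIMSEQ_subseq_LIMSEQ)
  \<comment> \<open>Since \<open>L t0 x0 v0\<close> may be \<infinity>, the bound is first proved
    for each real \<open>c\<close> below it.\<close>
  have main: "subderivative ?V (t0, x0) (1, v0) \<le> - ereal c" if c: "ereal c < L t0 x0 v0" for c
  proof (rule ccontr)
    assume not: "\<not> subderivative ?V (t0, x0) (1, v0) \<le> - ereal c"
    obtain v1 where v1: "L t0 x0 v1 \<noteq> \<infinity>" using L2_proper t0T by blast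
    obtain p \<beta> where min: "\<And>v. ereal (\<beta> + p \<bullet> v) < L t0 x0 v" "c < \<beta> + p \<bullet> v0"
    proof (rule affine_minorant[of "L t0 x0" v1 c v0])
      show "L t0 x0 (a *\<^sub>R u + (1 - a) *\<^sub>R w) \<le> ereal a * L t0 x0 u + ereal (1 - a) * L t0 x0 w"
        if "0 \<le> a" "a \<le> 1" for u w a
        using L2_convex t0T that by simp
      show "L t0 x0 v \<noteq> - \<infinity>" for v using L2_proper t0T by simp
    qed (use v1 c closed_epigraph[OF L1 t0T] in auto)
    have "\<exists>\<delta>>0. \<forall>t\<in>{0..T}. \<forall>x v. dist t t0 < \<delta> \<longrightarrow> dist x x0 < \<delta> \<longrightarrow> ereal (\<beta> + p \<bullet> v) \<le> L t x v"
      by (rule affine_minorant_nearby[OF L1 t0T _ min(1)]) (rule C(2))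
    then obtain \<delta> where \<delta>: "\<delta> > 0" "\<And>t x v. t \<in> {0..T} \<Longrightarrow> dist t t0 < \<delta> \<Longrightarrow> dist x x0 < \<delta> \<Longrightarrow> ereal (\<beta> + p \<bullet> v) \<le> L t x v"
      by blast
    \<comment> \<open>The sequence converges in the filter defining the subderivative, so a strict
      lower bound on that lower limit holds eventually along it.\<close>
    have "filterlim (\<lambda>n. ((\<tau> \<circ> r) n, (1::real, (vs \<circ> r) n))) (at_right 0 \<times>\<^sub>F nhds (1, v0)) sequentially"
    proof (rule filterlim_Pair)
      show "filterlim (\<tau> \<circ> r) (at_right 0) sequentially"
        using \<tau>(1) by (intro tendsto_imp_filterlim_at_right[OF \<tau>r]) (auto simp: o_def)
      show "filterlim (\<lambda>n. (1::real, (vs \<circ> r) n)) (nhds (1, v0)) sequentially"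
        using r(2) by (intro tendsto_Pair tendsto_const)
    qed
    moreover have "\<forall>\<^sub>F z in at_right 0 \<times>\<^sub>F nhds (1, v0). - ereal c < (\<lambda>(\<tau>, y). (?V ((t0, x0) + \<tau> *\<^sub>R y) - ?V (t0, x0)) / ereal \<tau>) z"
      using not unfolding subderivative_def by (intro less_LiminfD) simp
    ultimately have "\<forall>\<^sub>F n in sequentially. - ereal c < (\<lambda>(\<tau>, y). (?V ((t0, x0) + \<tau> *\<^sub>R y) - ?V (t0, x0)) / ereal \<tau>) ((\<tau> \<circ> r) n, (1::real, (vs \<circ> r) n))"
      by (rule eventually_compose_filterlim[rotated])
    \<comment> \<open>These are the upper bounds for the quotients; the first term is the tolerance
      divided by the step.\<close>
    moreover have "(\<lambda>n. (\<tau> \<circ> r) n - (\<beta> + p \<bullet> (vs \<circ> r) n)) \<longlonglongrightarrow> 0 - (\<beta> + p \<bullet> v0)"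
      using r(2) \<tau>r by (intro tendsto_intros)
    then have "\<forall>\<^sub>F n in sequentially. (\<tau> \<circ> r) n - (\<beta> + p \<bullet> (vs \<circ> r) n) < - c"
      using min(2) by (intro order_tendstoD(2)) auto
    moreover have "\<forall>\<^sub>F n in sequentially. (\<tau> \<circ> r) n < \<delta>"
      using \<tau>r \<delta>(1) by (intro order_tendstoD(2))
    moreover have "(\<lambda>n. C * (\<tau> \<circ> r) n) \<longlonglongrightarrow> C * 0" using \<tau>r by (intro tendsto_intros)
    then have "\<forall>\<^sub>F n in sequentially. C * (\<tau> \<circ> r) n < \<delta>"
      using \<delta>(1) by (intro order_tendstoD(2)) auto
    ultimately have "\<forall>\<^sub>F n in sequentially. False"
    proof eventually_elim
      case (elim n)
      define h w where "h = \<tau> (r n)" and "w = vs (r n)"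
      have h: "h > 0" using \<tau>(1) by (simp add: h_def)
      have "?V (t0 + h, x0 + h *\<^sub>R w) \<le> ereal (V0 + h\<^sup>2 - h * (\<beta> + p \<bullet> w))"
        using vs elim(3,4) \<delta>(2) unfolding h_def w_def o_def by blast
      \<comment> \<open>The value at the new point may be -\<infinity>, hence the case
        distinction.\<close>
      then have "?V (t0 + h, x0 + h *\<^sub>R w) - ereal V0 \<le> ereal (h\<^sup>2 - h * (\<beta> + p \<bullet> w))"
        by (cases "?V (t0 + h, x0 + h *\<^sub>R w)") auto
      then have "(?V (t0 + h, x0 + h *\<^sub>R w) - ereal V0) / ereal h \<le> ereal (h\<^sup>2 - h * (\<beta> + p \<bullet> w)) / ereal h"
        using h by (intro ereal_divide_right_mono) auto
      also have "\<dots> = ereal (h - (\<beta> + p \<bullet> w))"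
        using h by (simp add: power2_eq_square diff_divide_distrib)
      also have "\<dots> < ereal (- c)" using elim(2) by (simp add: h_def w_def)
      finally show False using elim(1) V0 by (simp add: h_def w_def)
    qed
    then show False by simp
  qed
  \<comment> \<open>After negation, \<open>dense_le\<close> lets \<open>c\<close> increase to
    \<open>L t0 x0 v0\<close>, finite or not.\<close>
  have "L t0 x0 v0 \<le> - subderivative ?V (t0, x0) (1, v0)"
  proof (rule dense_le)
    fix y assume "y < L t0 x0 v0"
    then obtain c where c: "y < ereal c" "ereal c < L t0 x0 v0" using ereal_dense2 by blast
    have "- (- ereal c) \<le> - subderivative ?V (t0, x0) (1, v0)"
      unfolding ereal_minus_le_minus by (rule main[OF c(2)])
    then show "y \<le> - subderivative ?V (t0, x0) (1, v0)" using c(1) by auto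
  qed
  then have "- (- subderivative ?V (t0, x0) (1, v0)) \<le> - L t0 x0 v0"
    unfolding ereal_minus_le_minus .
  then show ?thesis by auto
qed

end
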